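(* Let $\mathcal{D}$ be a triangulated category with shift functor $[1]$ and let $m\text{-}\mathcal{H}$ be an $m$-extended heart (where $m$ is a positive integer). Then there are order preserving, mutually inverse bijections between (1) the poset of $s$-torsion pairs in $m\text{-}\mathcal{H}$, (2) the poset of $m$-extended hearts $m\text{-}\mathcal{E}$ with $m\text{-}\mathcal{E}\subseteq m\text{-}\mathcal{H}[m]*m\text{-}\mathcal{H}$ and $m\text{-}\mathcal{H}\subseteq m\text{-}\mathcal{E}*m\text{-}\mathcal{E}[-m]$.
   Context: All categories are skeletally small; all subcategories are full and closed under isomorphisms. For subcategories $\mathcal{X},\mathcal{Y}$ of $\mathcal{D}$, $\mathcal{X}*\mathcal{Y}$ is the subcategory of objects $A$ admitting a distinguished triangle $X\to A\to Y\to X[1]$ with $X\in\mathcal{X}$, $Y\in\mathcal{Y}$ (this operation is associative). A $t$-structure on $\mathcal{D}$ is a pair $(\mathcal{U}^{\leqslant 0},\mathcal{U}^{\geqslant 0})$ of subcategories such that, writing $\mathcal{U}^{\leqslant n}=\mathcal{U}^{\leqslant 0}[-n]$, $\mathcal{U}^{\geqslant n}=\mathcal{U}^{\geqslant 0}[-n]$: $\mathcal{D}(\mathcal{U}^{\leqslant 0},\mathcal{U}^{\geqslant 1})=0$, $\mathcal{D}=\mathcal{U}^{\leqslant 0}*\mathcal{U}^{\geqslant 1}$, $\mathcal{U}^{\leqslant 0}\subseteq\mathcal{U}^{\leqslant 1}$, $\mathcal{U}^{\geqslant 1}\subseteq\mathcal{U}^{\geqslant 0}$. Its heart is $\mathcal{H}=\mathcal{U}^{\leqslant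 0}\cap\mathcal{U}^{\geqslant 0}$, and its $m$-extended heart is $m\text{-}\mathcal{H}=\mathcal{U}^{\geqslant -(m-1)}\cap\mathcal{U}^{\leqslant 0}=\mathcal{H}[m-1]*\mathcal{H}[m-2]*\cdots*\mathcal{H}$. An $m$-extended heart on $\mathcal{D}$ is a subcategory that is the $m$-extended heart of some $t$-structure on $\mathcal{D}$. An $s$-torsion pair in $m\text{-}\mathcal{H}$ (an extension-closed subcategory of $\mathcal{D}$, regarded as an extriangulated category with negative first extension $\mathbb{E}^{-1}(-,-)=\mathcal{D}(-,-[-1])$) is a pair $(\mathcal{T},\mathcal{F})$ of additive subcategories of $m\text{-}\mathcal{H}$ closed under direct sums and direct summands with $\mathcal{D}(\mathcal{T},\mathcal{F})=0$, $m\text{-}\mathcal{H}=\mathcal{T}*\mathcal{F}$ and $\mathcal{D}(\mathcal{T},\mathcal{F}[-1])=0$. The $s$-torsion pairs are partially ordered by $(\mathcal{T}_1,\mathcal{F}_1)\preccurlyeq(\mathcal{T}_2,\mathcal{F}_2)$ iff $\mathcal{T}_1\subseteq\mathcal{T}_2$. For $m$-extended hearts, $m\text{-}\mathcal{E}_1\leqslant m\text{-}\mathcal{E}_2$ means $m\text{-}\mathcal{E}_1\subseteq m\text{-}\mathcal{E}_2[m]*m\text{-}\mathcal{E}_2$ and $m\text{-}\mathcal{E}_2\subseteq m\text{-}\mathcal{E}_1*m\text{-}\mathcal{E}_1[-m]$. The set in (2) consists of those $m\text{-}\mathcal{E}$ with $m\text{-}\mathcal{E}\leqslant m\text{-}\mathcal{H}$;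 the relation $\leqslant$ restricted to this set is a partial order, and it is the order on (2). *)

theory Defs
  imports "HOL-Algebra.Group"
begin

section \<open>Categories\<close>

text \<open>
  Objects and arrows are carrier sets. Every arrow has a unique domain and codomain, so
  composition, addition and the shift on arrows need no object indices. Operations are
  unconstrained on arguments that are not arrows, or that do not fit together.
\<close>

record ('o, 'a) category =
  Ob  :: "'o set"
  Arr :: "'a set"
  Dom :: "'a \<Rightarrow> 'o"
  Cod :: "'a \<Rightarrow> 'o"
  Id  :: "'o \<Rightarrow> 'a"
  Comp :: "'a \<Rightarrow> 'a \<Rightarrow> 'a"  (infixr "\<bullet>\<index>" 75)

definition Hom :: "('o, 'a, 'z) category_scheme \<Rightarrow> 'o \<Rightarrow> 'o \<Rightarrow> 'a set" where
  "Hom C X Y = {f \<in> Arr C. Dom C f = X \<and> Cod C f = Y}"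

locale category =
  fixes C (structure)
  assumes Dom_in_Ob: "f \<in> Arr C \<Longrightarrow> Dom C f \<in> Ob C"
    and Cod_in_Ob: "f \<in> Arr C \<Longrightarrow> Cod C f \<in> Ob C"
    and Id_in_Hom: "X \<in> Ob C \<Longrightarrow> Id C X \<in> Hom C X X"
    and Comp_in_Hom: "\<lbrakk>f \<in> Hom C X Y; g \<in> Hom C Y Z\<rbrakk> \<Longrightarrow> g \<bullet> f \<in> Hom C X Z"
    and Comp_Id_right: "f \<in> Hom C X Y \<Longrightarrow> f \<bullet> Id C X = f"
    and Comp_Id_left: "f \<in> Hom C X Y \<Longrightarrow> Id C Y \<bullet> f = f"
    and Comp_assoc: "\<lbrakk>f \<in> Hom C W X; g \<in> Hom C X Y; h \<in> Hom C Y Z\<rbrakk> \<Longrightarrow>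
      (h \<bullet> g) \<bullet> f = h \<bullet> (g \<bullet> f)"

definition is_iso :: "('o, 'a, 'z) category_scheme \<Rightarrow> 'o \<Rightarrow> 'o \<Rightarrow> 'a \<Rightarrow> bool" where
  "is_iso C X Y f \<longleftrightarrow> f \<in> Hom C X Y \<and>
     (\<exists>g \<in> Hom C Y X. Comp C g f = Id C X \<and> Comp C f g = Id C Y)"

definition isomorphic :: "('o, 'a, 'z) category_scheme \<Rightarrow> 'o \<Rightarrow> 'o \<Rightarrow> bool" where
  "isomorphic C X Y \<longleftrightarrow> (\<exists>f. is_iso C X Y f)"

definition is_zero_object :: "('o, 'a, 'z) category_scheme \<Rightarrow> 'o \<Rightarrow> bool" where
  "is_zero_object C Z \<longleftrightarrow> Z \<in> Ob C \<and>
     (\<forall>X \<in> Ob C. (\<exists>!f. f \<in> Hom C Z X) \<and> (\<exists>!f. f \<in> Hom C X Z))"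


section \<open>Additive categories\<close>

record ('o, 'a) preadditive_category = "('o, 'a) category" +
  Add  :: "'a \<Rightarrow> 'a \<Rightarrow> 'a"  (infixl "\<boxplus>\<index>" 65)
  Zero :: "'o \<Rightarrow> 'o \<Rightarrow> 'a"

definition hom_group :: "('o, 'a, 'z) preadditive_category_scheme \<Rightarrow> 'o \<Rightarrow> 'o \<Rightarrow> 'a monoid" where
  "hom_group C X Y = \<lparr>carrier = Hom C X Y, mult = Add C, one = Zero C X Y\<rparr>"

definition Neg :: "('o, 'a, 'z) preadditive_category_scheme \<Rightarrow> 'a \<Rightarrow> 'a" where
  "Neg C f = inv\<^bsub>hom_group C (Dom C f) (Cod C f)\<^esub> f"

locale preadditive_category = category +
  assumes hom_comm_group: "\<lbrakk>X \<in> Ob C; Y \<in> Ob C\<rbrakk> \<Longrightarrow> comm_group (hom_group C X Y)"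
    and Comp_Add_right: "\<lbrakk>f \<in> Hom C X Y; f' \<in> Hom C X Y; g \<in> Hom C Y Z\<rbrakk> \<Longrightarrow>
      g \<bullet> (f \<boxplus> f') = g \<bullet> f \<boxplus> g \<bullet> f'"
    and Comp_Add_left: "\<lbrakk>f \<in> Hom C X Y; g \<in> Hom C Y Z; g' \<in> Hom C Y Z\<rbrakk> \<Longrightarrow>
      (g \<boxplus> g') \<bullet> f = g \<bullet> f \<boxplus> g' \<bullet> f"

definition is_direct_sum ::
    "('o, 'a, 'z) preadditive_category_scheme \<Rightarrow> 'o \<Rightarrow> 'o \<Rightarrow> 'o \<Rightarrow> bool" where
  "is_direct_sum C A B S \<longleftrightarrow> A \<in> Ob C \<and> B \<in> Ob C \<and> S \<in> Ob C \<and>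
     (\<exists>i\<^sub>1 \<in> Hom C A S. \<exists>i\<^sub>2 \<in> Hom C B S. \<exists>p\<^sub>1 \<in> Hom C S A. \<exists>p\<^sub>2 \<in> Hom C S B.
        Comp C p\<^sub>1 i\<^sub>1 = Id C A \<and> Comp C p\<^sub>2 i\<^sub>2 = Id C B \<and>
        Comp C p\<^sub>1 i\<^sub>2 = Zero C B A \<and> Comp C p\<^sub>2 i\<^sub>1 = Zero C A B \<and>
        Add C (Comp C i\<^sub>1 p\<^sub>1) (Comp C i\<^sub>2 p\<^sub>2) = Id C S)"

locale additive_category = preadditive_category +
  assumes ex_zero_object: "\<exists>Z. is_zero_object C Z"
    and ex_direct_sum: "\<lbrakk>A \<in> Ob C; B \<in> Ob C\<rbrakk> \<Longrightarrow> \<exists>S. is_direct_sum C A B S"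


section \<open>Triangulated categories\<close>

text \<open>
  A triple \<open>(f, g, h)\<close> in \<open>Tri\<close> is a distinguished triangle \<open>X \<rightarrow> Y \<rightarrow> Z \<rightarrow> X[1]\<close>; its
  objects are determined by its arrows. The shift is only required to be an additive
  autoequivalence (fully faithful and essentially surjective); a strict automorphism is a
  special case.
\<close>

record ('o, 'a) triangulated_category = "('o, 'a) preadditive_category" +
  Sh  :: "'o \<Rightarrow> 'o"
  ShA :: "'a \<Rightarrow> 'a"
  Tri :: "('a \<times> 'a \<times> 'a) set"

definition is_triangle :: "('o, 'a, 'z) triangulated_category_scheme \<Rightarrow>
    'o \<Rightarrow> 'o \<Rightarrow> 'o \<Rightarrow> 'a \<Rightarrow> 'a \<Rightarrow> 'a \<Rightarrow> bool" where
  "is_triangle C X Y Z f g h \<longleftrightarrow>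
     f \<in> Hom C X Y \<and> g \<in> Hom C Y Z \<and> h \<in> Hom C Z (Sh C X)"

definition dist_triangle :: "('o, 'a, 'z) triangulated_category_scheme \<Rightarrow>
    'o \<Rightarrow> 'o \<Rightarrow> 'o \<Rightarrow> 'a \<Rightarrow> 'a \<Rightarrow> 'a \<Rightarrow> bool" where
  "dist_triangle C X Y Z f g h \<longleftrightarrow> is_triangle C X Y Z f g h \<and> (f, g, h) \<in> Tri C"

locale triangulated_category = additive_category +
  assumes Sh_in_Ob: "X \<in> Ob C \<Longrightarrow> Sh C X \<in> Ob C"
    and ShA_in_Hom: "f \<in> Hom C X Y \<Longrightarrow> ShA C f \<in> Hom C (Sh C X) (Sh C Y)"
    and ShA_Id: "X \<in> Ob C \<Longrightarrow> ShA C (Id C X) = Id C (Sh C X)"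
    and ShA_Comp: "\<lbrakk>f \<in> Hom C X Y; g \<in> Hom C Y Z\<rbrakk> \<Longrightarrow> ShA C (g \<bullet> f) = ShA C g \<bullet> ShA C f"
    and ShA_Add: "\<lbrakk>f \<in> Hom C X Y; g \<in> Hom C X Y\<rbrakk> \<Longrightarrow> ShA C (f \<boxplus> g) = ShA C f \<boxplus> ShA C g"
    and ShA_fully_faithful: "\<lbrakk>X \<in> Ob C; Y \<in> Ob C\<rbrakk> \<Longrightarrow>
      bij_betw (ShA C) (Hom C X Y) (Hom C (Sh C X) (Sh C Y))"
    and Sh_ess_surj: "Y \<in> Ob C \<Longrightarrow> \<exists>X \<in> Ob C. isomorphic C (Sh C X) Y"
    and Tri_is_triangle: "(f, g, h) \<in> Tri C \<Longrightarrow> \<exists>X Y Z. is_triangle C X Y Z f g h"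
    and TR1_iso: "\<lbrakk>dist_triangle C X Y Z f g h; is_triangle C X' Y' Z' f' g' h';
      is_iso C X X' a; is_iso C Y Y' b; is_iso C Z Z' c;
      b \<bullet> f = f' \<bullet> a; c \<bullet> g = g' \<bullet> b; ShA C a \<bullet> h = h' \<bullet> c\<rbrakk> \<Longrightarrow>
      dist_triangle C X' Y' Z' f' g' h'"
    and TR1_Id: "\<lbrakk>X \<in> Ob C; is_zero_object C Z\<rbrakk> \<Longrightarrow>
      dist_triangle C X X Z (Id C X) (Zero C X Z) (Zero C Z (Sh C X))"
    and TR1_cone: "f \<in> Hom C X Y \<Longrightarrow> \<exists>Z g h. dist_triangle C X Y Z f g h"
    and TR2: "is_triangle C X Y Z f g h \<Longrightarrow>
      dist_triangle C X Y Z f g h \<longleftrightarrow> dist_triangle C Y Z (Sh C X) g h (Neg C (ShA C f))"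
    and TR3: "\<lbrakk>dist_triangle C X Y Z f g h; dist_triangle C X' Y' Z' f' g' h';
      a \<in> Hom C X X'; b \<in> Hom C Y Y'; b \<bullet> f = f' \<bullet> a\<rbrakk> \<Longrightarrow>
      \<exists>c \<in> Hom C Z Z'. c \<bullet> g = g' \<bullet> b \<and> ShA C a \<bullet> h = h' \<bullet> c"
    and TR4_octahedral: "\<lbrakk>dist_triangle C X Y Z' f f' f''; dist_triangle C Y Z X' g g' g'';
      dist_triangle C X Z Y' (g \<bullet> f) h' h''\<rbrakk> \<Longrightarrow>
      \<exists>u v. dist_triangle C Z' Y' X' u v (ShA C f' \<bullet> g'') \<and>
        u \<bullet> f' = h' \<bullet> g \<and> h'' \<bullet> u = f'' \<and> v \<bullet> h' = g' \<and> g'' \<bullet> v = ShA C f \<bullet> h''"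


section \<open>Subcategories\<close>

text \<open>
  All subcategories are full and closed under isomorphisms, hence are given by their sets of
  objects.
\<close>

definition subcategory :: "('o, 'a, 'z) category_scheme \<Rightarrow> 'o set \<Rightarrow> bool" where
  "subcategory C \<U> \<longleftrightarrow> \<U> \<subseteq> Ob C \<and> (\<forall>A B. A \<in> \<U> \<and> isomorphic C A B \<longrightarrow> B \<in> \<U>)"

definition additive_subcategory ::
    "('o, 'a, 'z) preadditive_category_scheme \<Rightarrow> 'o set \<Rightarrow> bool" where
  "additive_subcategory C \<U> \<longleftrightarrow> subcategory C \<U> \<and>
     (\<exists>Z. is_zero_object C Z \<and> Z \<in> \<U>) \<and>
     (\<forall>A B S. A \<in> \<U> \<and> B \<in> \<U> \<and> is_direct_sum C A B S \<longrightarrow> S \<in> \<U>)"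

definition closed_under_summands ::
    "('o, 'a, 'z) preadditive_category_scheme \<Rightarrow> 'o set \<Rightarrow> bool" where
  "closed_under_summands C \<U> \<longleftrightarrow>
     (\<forall>A B S. is_direct_sum C A B S \<and> S \<in> \<U> \<longrightarrow> A \<in> \<U> \<and> B \<in> \<U>)"

definition hom_vanishes ::
    "('o, 'a, 'z) preadditive_category_scheme \<Rightarrow> 'o set \<Rightarrow> 'o set \<Rightarrow> bool" where
  "hom_vanishes C \<U> \<V> \<longleftrightarrow> (\<forall>X \<in> \<U>. \<forall>Y \<in> \<V>. Hom C X Y = {Zero C X Y})"

text \<open>
  The subcategory \<open>\<U>[n]\<close> for an integer \<open>n\<close>. As no inverse of the shift functor is chosen,
  \<open>B \<cong> A[n]\<close> is expressed for \<open>n < 0\<close> as \<open>B[-n] \<cong> A\<close>; one of the two exponents below is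
  always \<open>0\<close>.
\<close>

definition shift_sub ::
    "('o, 'a, 'z) triangulated_category_scheme \<Rightarrow> 'o set \<Rightarrow> int \<Rightarrow> 'o set" where
  "shift_sub C \<U> n =
     {B \<in> Ob C. \<exists>A \<in> \<U>. isomorphic C ((Sh C ^^ nat (- n)) B) ((Sh C ^^ nat n) A)}"

definition star ::
    "('o, 'a, 'z) triangulated_category_scheme \<Rightarrow> 'o set \<Rightarrow> 'o set \<Rightarrow> 'o set" where
  "star C \<X> \<Y> = {A \<in> Ob C. \<exists>X \<in> \<X>. \<exists>Y \<in> \<Y>. \<exists>f g h. dist_triangle C X A Y f g h}"


section \<open>t-structures, extended hearts and s-torsion pairs\<close>

text \<open>
  \<open>\<U>\<close> and \<open>\<V>\<close> are the two halves in degrees \<open>\<le> 0\<close> and \<open>\<ge> 0\<close>. In cohomological indexing the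
  halves in degrees \<open>\<le> n\<close> and \<open>\<ge> n\<close> are \<open>\<U>[-n]\<close> and \<open>\<V>[-n]\<close>.
\<close>

definition t_structure ::
    "('o, 'a, 'z) triangulated_category_scheme \<Rightarrow> 'o set \<Rightarrow> 'o set \<Rightarrow> bool" where
  "t_structure C \<U> \<V> \<longleftrightarrow> subcategory C \<U> \<and> subcategory C \<V> \<and>
     hom_vanishes C \<U> (shift_sub C \<V> (- 1)) \<and>
     Ob C = star C \<U> (shift_sub C \<V> (- 1)) \<and>
     \<U> \<subseteq> shift_sub C \<U> (- 1) \<and>
     shift_sub C \<V> (- 1) \<subseteq> \<V>"

definition extended_heart_of ::
    "('o, 'a, 'z) triangulated_category_scheme \<Rightarrow> nat \<Rightarrow> 'o set \<Rightarrow> 'o set \<Rightarrow> 'o set" where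
  "extended_heart_of C m \<U> \<V> = shift_sub C \<V> (int m - 1) \<inter> \<U>"

definition extended_heart ::
    "('o, 'a, 'z) triangulated_category_scheme \<Rightarrow> nat \<Rightarrow> 'o set \<Rightarrow> bool" where
  "extended_heart C m \<E> \<longleftrightarrow> (\<exists>\<U> \<V>. t_structure C \<U> \<V> \<and> \<E> = extended_heart_of C m \<U> \<V>)"

text \<open>
  The last condition is the vanishing of the negative first extensions
  \<open>\<E>\<^sup>-\<^sup>1(\<T>, \<F>) = D(\<T>, \<F>[-1])\<close>.
\<close>

definition s_torsion_pair ::
    "('o, 'a, 'z) triangulated_category_scheme \<Rightarrow> 'o set \<Rightarrow> 'o set \<Rightarrow> 'o set \<Rightarrow> bool" where
  "s_torsion_pair C \<H> \<T> \<F> \<longleftrightarrow> \<T> \<subseteq> \<H> \<and> \<F> \<subseteq> \<H> \<and>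
     additive_subcategory C \<T> \<and> closed_under_summands C \<T> \<and>
     additive_subcategory C \<F> \<and> closed_under_summands C \<F> \<and>
     hom_vanishes C \<T> \<F> \<and> \<H> = star C \<T> \<F> \<and>
     hom_vanishes C \<T> (shift_sub C \<F> (- 1))"

definition s_torsion_pairs ::
    "('o, 'a, 'z) triangulated_category_scheme \<Rightarrow> 'o set \<Rightarrow> ('o set \<times> 'o set) set" where
  "s_torsion_pairs C \<H> = {(\<T>, \<F>). s_torsion_pair C \<H> \<T> \<F>}"

definition torsion_le :: "'o set \<times> 'o set \<Rightarrow> 'o set \<times> 'o set \<Rightarrow> bool" where
  "torsion_le P Q \<longleftrightarrow> fst P \<subseteq> fst Q"

definition heart_le ::
    "('o, 'a, 'z) triangulated_category_scheme \<Rightarrow> nat \<Rightarrow> 'o set \<Rightarrow> 'o set \<Rightarrow> bool" where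
  "heart_le C m \<E>\<^sub>1 \<E>\<^sub>2 \<longleftrightarrow>
     \<E>\<^sub>1 \<subseteq> star C (shift_sub C \<E>\<^sub>2 (int m)) \<E>\<^sub>2 \<and>
     \<E>\<^sub>2 \<subseteq> star C \<E>\<^sub>1 (shift_sub C \<E>\<^sub>1 (- int m))"

definition extended_hearts_below ::
    "('o, 'a, 'z) triangulated_category_scheme \<Rightarrow> nat \<Rightarrow> 'o set \<Rightarrow> 'o set set" where
  "extended_hearts_below C m \<H> = {\<E>. extended_heart C m \<E> \<and> heart_le C m \<E> \<H>}"

definition is_poset :: "'p set \<Rightarrow> ('p \<Rightarrow> 'p \<Rightarrow> bool) \<Rightarrow> bool" where
  "is_poset A R \<longleftrightarrow> partial_order_on A {(x, y). x \<in> A \<and> y \<in> A \<and> R x y}"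

end

theory Submission
  imports Defs
begin

text \<open>
  Write a t-structure as a pair \<open>(U, W)\<close> with \<open>U\<close> its half in degrees \<open>\<le> 0\<close> and \<open>W\<close> its half in
  degrees \<open>\<ge> 1\<close>. Such pairs are exactly the s-torsion pairs of the whole category: the vanishing of
  \<open>Hom(U, W)\<close> and \<open>Hom(U, W[-1])\<close> together with \<open>D = U * W\<close> makes each half the orthogonal of the
  other, and closure under shifts follows (\<open>aisle_pair_orth\<close>). The \<open>m\<close>-extended heart is
  \<open>H = W[m] \<inter> U\<close>, and truncation of \<open>U\<close> gives \<open>U = U[m] * H\<close> (\<open>aisle_decomp\<close>).

  Given an s-torsion pair \<open>(T, F)\<close> in \<open>H\<close>, cut \<open>D = U[m] * H * W = U[m] * T * F * W\<close> in the middle.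
  Associativity of \<open>*\<close> turns this into a new t-structure \<open>(U[m] * T, F * W)\<close>, whose \<open>m\<close>-extended
  heart is \<open>F[m] * T\<close> (\<open>tilt_aisle_pair\<close>, \<open>tilt_extended_heart\<close>). Conversely, an extended heart
  \<open>E\<close> below \<open>H\<close> yields the s-torsion pair \<open>(E \<inter> H, E[-m] \<inter> H)\<close>: the inclusion \<open>H \<subseteq> E * E[-m]\<close>
  provides the decomposition triangles, and \<open>E \<subseteq> H[m] * H\<close> forces their outer terms into \<open>H\<close>
  (\<open>heart_below_s_torsion_pair\<close>). In the absence of boundedness an extended heart does not determine
  its t-structure, so this construction refers to \<open>E\<close> only.

  That the two maps are mutually inverse, and that \<open>\<le>\<close> on hearts below \<open>H\<close> is inclusion of torsion
  classes, comes from one device. In a triangle \<open>X \<rightarrow> A \<rightarrow> Y \<rightarrow> X[1]\<close> with \<open>Hom(X, A) = 0\<close> or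
  \<open>Hom(A, Y) = 0\<close>, the object \<open>A\<close> is a direct summand of \<open>Y\<close> or of \<open>X\<close>
  (\<open>triangle_retract_right\<close>, \<open>triangle_retract_left\<close>). As torsion classes determine their
  s-torsion pairs, \<open>\<le>\<close> inherits reflexivity, transitivity and antisymmetry from inclusion.
\<close>

section \<open>Retracts and additive structure\<close>

context category
begin

lemma Hom_Ob:
  assumes "f \<in> Hom C X Y"
  shows "X \<in> Ob C" "Y \<in> Ob C"
  using assms Dom_in_Ob Cod_in_Ob by (auto simp: Hom_def)

lemma is_iso_Id: "X \<in> Ob C \<Longrightarrow> is_iso C X X (Id C X)"
  unfolding is_iso_def using Id_in_Hom Comp_Id_left by metis

lemma is_iso_Comp:
  assumes "is_iso C X Y f" "is_iso C Y Z g"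
  shows "is_iso C X Z (g \<bullet> f)"
proof -
  obtain f' where f: "f \<in> Hom C X Y" "f' \<in> Hom C Y X" "f' \<bullet> f = Id C X" "f \<bullet> f' = Id C Y"
    using assms by (auto simp: is_iso_def)
  obtain g' where g: "g \<in> Hom C Y Z" "g' \<in> Hom C Z Y" "g' \<bullet> g = Id C Y" "g \<bullet> g' = Id C Z"
    using assms by (auto simp: is_iso_def)
  have 1: "f' \<bullet> g' \<in> Hom C Z X" "g \<bullet> f \<in> Hom C X Z" using f g Comp_in_Hom by blast+
  have "(f' \<bullet> g') \<bullet> (g \<bullet> f) = f' \<bullet> (g' \<bullet> (g \<bullet> f))"
    using Comp_assoc[OF 1(2) g(2) f(2)] .
  also have "g' \<bullet> (g \<bullet> f) = f"
    using Comp_assoc[OF f(1) g(1) g(2)] g(3) Comp_Id_left[OF f(1)] by simp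
  finally have 2: "(f' \<bullet> g') \<bullet> (g \<bullet> f) = Id C X" using f by simp
  have "(g \<bullet> f) \<bullet> (f' \<bullet> g') = g \<bullet> (f \<bullet> (f' \<bullet> g'))"
    using Comp_assoc[OF 1(1) f(1) g(1)] .
  also have "f \<bullet> (f' \<bullet> g') = g'"
    using Comp_assoc[OF g(2) f(2) f(1)] f(4) Comp_Id_left[OF g(2)] by simp
  finally have 3: "(g \<bullet> f) \<bullet> (f' \<bullet> g') = Id C Z" using g by simp
  show ?thesis unfolding is_iso_def using 1 2 3 by blast
qed

lemma isomorphic_refl: "X \<in> Ob C \<Longrightarrow> isomorphic C X X"
  unfolding isomorphic_def using is_iso_Id by blast

lemma isomorphic_sym: "isomorphic C X Y \<Longrightarrow> isomorphic C Y X"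
  unfolding isomorphic_def is_iso_def by blast

lemma isomorphic_trans: "isomorphic C X Y \<Longrightarrow> isomorphic C Y Z \<Longrightarrow> isomorphic C X Z"
  unfolding isomorphic_def using is_iso_Comp by blast

lemma isomorphic_Ob: "isomorphic C X Y \<Longrightarrow> X \<in> Ob C \<and> Y \<in> Ob C"
  unfolding isomorphic_def is_iso_def using Hom_Ob by blast

lemma isomorphicE:
  assumes "isomorphic C X Y"
  obtains f g where "f \<in> Hom C X Y" "g \<in> Hom C Y X" "g \<bullet> f = Id C X" "f \<bullet> g = Id C Y"
  using assms by (auto simp: isomorphic_def is_iso_def)

definition retract where
  "retract A S \<longleftrightarrow> (\<exists>i \<in> Hom C A S. \<exists>p \<in> Hom C S A. p \<bullet> i = Id C A)"

lemma isomorphic_retract: "isomorphic C X Y \<Longrightarrow> retract X Y"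
  unfolding retract_def isomorphic_def is_iso_def by blast

lemma retract_Ob: "retract A S \<Longrightarrow> A \<in> Ob C \<and> S \<in> Ob C"
  unfolding retract_def using Hom_Ob by blast

lemma retract_trans:
  assumes "retract A B" "retract B S"
  shows "retract A S"
proof -
  obtain i p where 1: "i \<in> Hom C A B" "p \<in> Hom C B A" "p \<bullet> i = Id C A"
    using assms by (auto simp: retract_def)
  obtain j q where 2: "j \<in> Hom C B S" "q \<in> Hom C S B" "q \<bullet> j = Id C B"
    using assms by (auto simp: retract_def)
  have 3: "j \<bullet> i \<in> Hom C A S" "p \<bullet> q \<in> Hom C S A" using 1 2 Comp_in_Hom by blast+
  have "(p \<bullet> q) \<bullet> (j \<bullet> i) = p \<bullet> (q \<bullet> (j \<bullet> i))" using Comp_assoc[OF 3(1) 2(2) 1(2)] .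
  also have "q \<bullet> (j \<bullet> i) = i"
    using Comp_assoc[OF 1(1) 2(1) 2(2)] 2(3) Comp_Id_left[OF 1(1)] by simp
  finally show ?thesis unfolding retract_def using 1 3 by metis
qed

end

context preadditive_category
begin

lemma Zero_in_Hom: "X \<in> Ob C \<Longrightarrow> Y \<in> Ob C \<Longrightarrow> Zero C X Y \<in> Hom C X Y"
  using comm_group.axioms(2)[OF hom_comm_group] group.is_monoid monoid.one_closed
  by (fastforce simp: hom_group_def)

lemma Add_in_Hom: "f \<in> Hom C X Y \<Longrightarrow> g \<in> Hom C X Y \<Longrightarrow> f \<boxplus> g \<in> Hom C X Y"
  using monoid.m_closed[OF group.is_monoid[OF comm_group.axioms(2)[OF hom_comm_group[of X Y]]]] Hom_Ob
  by (fastforce simp: hom_group_def)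

lemma Add_Zero: "f \<in> Hom C X Y \<Longrightarrow> f \<boxplus> Zero C X Y = f"
  using monoid.r_one[OF group.is_monoid[OF comm_group.axioms(2)[OF hom_comm_group[of X Y]]]] Hom_Ob
  by (fastforce simp: hom_group_def)

lemma Zero_Add: "f \<in> Hom C X Y \<Longrightarrow> Zero C X Y \<boxplus> f = f"
  using monoid.l_one[OF group.is_monoid[OF comm_group.axioms(2)[OF hom_comm_group[of X Y]]]] Hom_Ob
  by (fastforce simp: hom_group_def)

lemma Neg_in_Hom: "f \<in> Hom C X Y \<Longrightarrow> Neg C f \<in> Hom C X Y"
  using group.inv_closed[OF comm_group.axioms(2)[OF hom_comm_group[of X Y]]] Hom_Ob
  by (fastforce simp: hom_group_def Neg_def Hom_def)

lemma Add_Neg: "f \<in> Hom C X Y \<Longrightarrow> f \<boxplus> Neg C f = Zero C X Y"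
  using group.r_inv[OF comm_group.axioms(2)[OF hom_comm_group[of X Y]]] Hom_Ob
  by (fastforce simp: hom_group_def Neg_def Hom_def)

lemma Add_right_cancel:
  "f \<in> Hom C X Y \<Longrightarrow> g \<in> Hom C X Y \<Longrightarrow> h \<in> Hom C X Y \<Longrightarrow> f \<boxplus> h = g \<boxplus> h \<Longrightarrow> f = g"
  using group.right_cancel[OF comm_group.axioms(2)[OF hom_comm_group[of X Y]]] Hom_Ob
  by (fastforce simp: hom_group_def)

lemma Add_commute: "f \<in> Hom C X Y \<Longrightarrow> g \<in> Hom C X Y \<Longrightarrow> f \<boxplus> g = g \<boxplus> f"
  using comm_monoid.m_comm[OF comm_group.axioms(1)[OF hom_comm_group[of X Y]]] Hom_Ob
  by (fastforce simp: hom_group_def)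

lemma Add_assoc: "f \<in> Hom C X Y \<Longrightarrow> g \<in> Hom C X Y \<Longrightarrow> h \<in> Hom C X Y \<Longrightarrow>
    (f \<boxplus> g) \<boxplus> h = f \<boxplus> (g \<boxplus> h)"
  using monoid.m_assoc[OF group.is_monoid[OF comm_group.axioms(2)[OF hom_comm_group[of X Y]]]] Hom_Ob
  by (fastforce simp: hom_group_def)

lemma Neg_unique:
  assumes "f \<in> Hom C X Y" "g \<in> Hom C X Y" "f \<boxplus> g = Zero C X Y"
  shows "g = Neg C f"
  using Add_right_cancel[of g X Y "Neg C f" f] assms Add_commute[of _ X Y] Add_Neg[of f X Y]
    Neg_in_Hom[of f X Y] by metis

lemma Neg_Neg: "f \<in> Hom C X Y \<Longrightarrow> Neg C (Neg C f) = f"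
  using Neg_unique[of "Neg C f" X Y f] Add_commute[of f X Y] Add_Neg[of f X Y] Neg_in_Hom[of f X Y]
  by metis

lemma Zero_if_Add_self: "f \<in> Hom C X Y \<Longrightarrow> f \<boxplus> f = f \<Longrightarrow> f = Zero C X Y"
  using Add_right_cancel[of f X Y "Zero C X Y" f] Zero_Add[of f X Y] Zero_in_Hom Hom_Ob by metis

lemma Comp_Zero_right: "g \<in> Hom C Y Z \<Longrightarrow> X \<in> Ob C \<Longrightarrow> g \<bullet> Zero C X Y = Zero C X Z"
  using Zero_if_Add_self[of "g \<bullet> Zero C X Y" X Z] Comp_Add_right[of "Zero C X Y" X Y "Zero C X Y" g Z]
    Zero_in_Hom[of X Y] Zero_Add[of "Zero C X Y" X Y] Comp_in_Hom Hom_Ob by metis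

lemma Comp_Zero_left: "f \<in> Hom C X Y \<Longrightarrow> Z \<in> Ob C \<Longrightarrow> Zero C Y Z \<bullet> f = Zero C X Z"
  using Zero_if_Add_self[of "Zero C Y Z \<bullet> f" X Z] Comp_Add_left[of f X Y "Zero C Y Z" Z "Zero C Y Z"]
    Zero_in_Hom[of Y Z] Zero_Add[of "Zero C Y Z" Y Z] Comp_in_Hom Hom_Ob by metis

lemma Comp_Neg_right: "f \<in> Hom C X Y \<Longrightarrow> g \<in> Hom C Y Z \<Longrightarrow> g \<bullet> Neg C f = Neg C (g \<bullet> f)"
  using Neg_unique[of "g \<bullet> f" X Z "g \<bullet> Neg C f"] Comp_Add_right[of f X Y "Neg C f" g Z]
    Add_Neg[of f X Y] Comp_Zero_right[of g Y Z X] Neg_in_Hom[of f X Y] Comp_in_Hom Hom_Ob by metis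

lemma Comp_Neg_left: "f \<in> Hom C X Y \<Longrightarrow> g \<in> Hom C Y Z \<Longrightarrow> Neg C g \<bullet> f = Neg C (g \<bullet> f)"
  using Neg_unique[of "g \<bullet> f" X Z "Neg C g \<bullet> f"] Comp_Add_left[of f X Y g Z "Neg C g"]
    Add_Neg[of g Y Z] Comp_Zero_left[of f X Y Z] Neg_in_Hom[of g Y Z] Comp_in_Hom Hom_Ob by metis

lemma hom_vanishes_singletonI:
  assumes "X \<in> Ob C" "Y \<in> Ob C" "\<And>f. f \<in> Hom C X Y \<Longrightarrow> f = Zero C X Y"
  shows "hom_vanishes C {X} {Y}"
  using assms Zero_in_Hom by (auto simp: hom_vanishes_def)

lemma hom_vanishes_singletonD:
  "hom_vanishes C {X} {Y} \<Longrightarrow> f \<in> Hom C X Y \<Longrightarrow> f = Zero C X Y"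
  by (auto simp: hom_vanishes_def)

lemma hom_vanishes_singleton_Id:
  assumes "X \<in> Ob C" "Id C X = Zero C X X" "Y \<in> Ob C"
  shows "hom_vanishes C {X} {Y}" "hom_vanishes C {Y} {X}"
proof -
  show "hom_vanishes C {X} {Y}"
    using assms Comp_Id_right Comp_Zero_right by (intro hom_vanishes_singletonI) metis+
  show "hom_vanishes C {Y} {X}"
    using assms Comp_Id_left Comp_Zero_left by (intro hom_vanishes_singletonI) metis+
qed

text \<open>
  An equation between arrows is easier to transport along functors and triangles than the two universal
  properties of a zero object.
\<close>

lemma is_zero_object_iff: "is_zero_object C Z \<longleftrightarrow> Z \<in> Ob C \<and> Id C Z = Zero C Z Z"
proof
  assume "is_zero_object C Z"
  then show "Z \<in> Ob C \<and> Id C Z = Zero C Z Z"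
    using Id_in_Hom Zero_in_Hom unfolding is_zero_object_def by blast
next
  assume Z: "Z \<in> Ob C \<and> Id C Z = Zero C Z Z"
  then show "is_zero_object C Z"
    using hom_vanishes_singleton_Id[of Z] unfolding is_zero_object_def hom_vanishes_def by simp
qed

lemma retract_hom_vanishes_left:
  assumes "retract A S" "hom_vanishes C {S} {Y}" "Y \<in> Ob C"
  shows "hom_vanishes C {A} {Y}"
proof -
  obtain i p where ip: "i \<in> Hom C A S" "p \<in> Hom C S A" "p \<bullet> i = Id C A"
    using assms by (auto simp: retract_def)
  show ?thesis
  proof (rule hom_vanishes_singletonI)
    fix f assume f: "f \<in> Hom C A Y"
    have "f = (f \<bullet> p) \<bullet> i" using Comp_assoc[OF ip(1,2) f] ip Comp_Id_right[OF f] by simp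
    also have "f \<bullet> p = Zero C S Y" using Comp_in_Hom[OF ip(2) f] assms hom_vanishes_singletonD by blast
    also have "Zero C S Y \<bullet> i = Zero C A Y" using Comp_Zero_left ip assms by blast
    finally show "f = Zero C A Y" .
  qed (use ip assms Hom_Ob in blast)+
qed

lemma retract_hom_vanishes_right:
  assumes "retract A S" "hom_vanishes C {Y} {S}" "Y \<in> Ob C"
  shows "hom_vanishes C {Y} {A}"
proof -
  obtain i p where ip: "i \<in> Hom C A S" "p \<in> Hom C S A" "p \<bullet> i = Id C A"
    using assms by (auto simp: retract_def)
  show ?thesis
  proof (rule hom_vanishes_singletonI)
    fix f assume f: "f \<in> Hom C Y A"
    have "f = p \<bullet> (i \<bullet> f)" using Comp_assoc[OF f ip(1,2)] ip Comp_Id_left[OF f] by simp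
    also have "i \<bullet> f = Zero C Y S" using Comp_in_Hom[OF f ip(1)] assms hom_vanishes_singletonD by blast
    also have "p \<bullet> Zero C Y S = Zero C Y A" using Comp_Zero_right ip assms by blast
    finally show "f = Zero C Y A" .
  qed (use ip assms Hom_Ob in blast)+
qed

lemma direct_sum_retract:
  assumes "is_direct_sum C A B S"
  shows "retract A S" "retract B S"
  using assms unfolding is_direct_sum_def retract_def by blast+

lemma direct_sum_hom_vanishes:
  assumes "is_direct_sum C A B S" "Y \<in> Ob C"
  shows "hom_vanishes C {A} {Y} \<Longrightarrow> hom_vanishes C {B} {Y} \<Longrightarrow> hom_vanishes C {S} {Y}"
    and "hom_vanishes C {Y} {A} \<Longrightarrow> hom_vanishes C {Y} {B} \<Longrightarrow> hom_vanishes C {Y} {S}"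
proof -
  obtain i j p q where S: "i \<in> Hom C A S" "j \<in> Hom C B S" "p \<in> Hom C S A" "q \<in> Hom C S B"
      "i \<bullet> p \<boxplus> j \<bullet> q = Id C S"
    using assms by (auto simp: is_direct_sum_def)
  have ij: "i \<bullet> p \<in> Hom C S S" "j \<bullet> q \<in> Hom C S S" using S Comp_in_Hom by blast+
  have Ob: "A \<in> Ob C" "B \<in> Ob C" "S \<in> Ob C" using S Hom_Ob by blast+
  show "hom_vanishes C {S} {Y}" if "hom_vanishes C {A} {Y}" "hom_vanishes C {B} {Y}"
  proof (rule hom_vanishes_singletonI)
    fix f assume f: "f \<in> Hom C S Y"
    have "f = f \<bullet> (i \<bullet> p) \<boxplus> f \<bullet> (j \<bullet> q)"
      using Comp_Add_right[OF ij f] S Comp_Id_right[OF f] by simp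
    also have "f \<bullet> (i \<bullet> p) = Zero C S Y"
      using Comp_assoc[OF S(3,1) f] that(1) hom_vanishes_singletonD[OF _ Comp_in_Hom[OF S(1) f]]
        Comp_Zero_left[OF S(3)] assms by simp
    also have "f \<bullet> (j \<bullet> q) = Zero C S Y"
      using Comp_assoc[OF S(4,2) f] that(2) hom_vanishes_singletonD[OF _ Comp_in_Hom[OF S(2) f]]
        Comp_Zero_left[OF S(4)] assms by simp
    finally show "f = Zero C S Y" using Add_Zero Zero_in_Hom assms Ob by metis
  qed (use Ob assms in auto)
  show "hom_vanishes C {Y} {S}" if "hom_vanishes C {Y} {A}" "hom_vanishes C {Y} {B}"
  proof (rule hom_vanishes_singletonI)
    fix f assume f: "f \<in> Hom C Y S"
    have "f = (i \<bullet> p) \<bullet> f \<boxplus> (j \<bullet> q) \<bullet> f"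
      using Comp_Add_left[OF f ij] S Comp_Id_left[OF f] by simp
    also have "(i \<bullet> p) \<bullet> f = Zero C Y S"
      using Comp_assoc[OF f S(3,1)] that(1) hom_vanishes_singletonD[OF _ Comp_in_Hom[OF f S(3)]]
        Comp_Zero_right[OF S(1)] assms by simp
    also have "(j \<bullet> q) \<bullet> f = Zero C Y S"
      using Comp_assoc[OF f S(4,2)] that(2) hom_vanishes_singletonD[OF _ Comp_in_Hom[OF f S(4)]]
        Comp_Zero_right[OF S(2)] assms by simp
    finally show "f = Zero C Y S" using Add_Zero Zero_in_Hom assms Ob by metis
  qed (use Ob assms in auto)
qed

end

section \<open>Triangles\<close>

context triangulated_category
begin

lemma ShA_inj: "f \<in> Hom C X Y \<Longrightarrow> g \<in> Hom C X Y \<Longrightarrow> ShA C f = ShA C g \<Longrightarrow> f = g"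
  using ShA_fully_faithful[of X Y] Hom_Ob by (meson bij_betw_def inj_on_def)

lemma ShA_surj:
  assumes "g \<in> Hom C (Sh C X) (Sh C Y)" "X \<in> Ob C" "Y \<in> Ob C"
  obtains f where "f \<in> Hom C X Y" "ShA C f = g"
proof -
  have "g \<in> ShA C ` Hom C X Y"
    using assms bij_betw_imp_surj_on[OF ShA_fully_faithful[OF assms(2,3)]] by simp
  then show ?thesis using that by (elim imageE) simp
qed

lemma ShA_Zero: "X \<in> Ob C \<Longrightarrow> Y \<in> Ob C \<Longrightarrow> ShA C (Zero C X Y) = Zero C (Sh C X) (Sh C Y)"
  using Zero_if_Add_self ShA_Add Zero_Add Zero_in_Hom ShA_in_Hom by metis

lemma is_iso_ShA: "is_iso C X Y f \<Longrightarrow> is_iso C (Sh C X) (Sh C Y) (ShA C f)"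
  unfolding is_iso_def using ShA_in_Hom ShA_Comp ShA_Id Hom_Ob by metis

lemma Neg_ShA_surj:
  assumes "g \<in> Hom C (Sh C X) (Sh C Y)" "X \<in> Ob C" "Y \<in> Ob C"
  obtains f where "f \<in> Hom C X Y" "Neg C (ShA C f) = g"
  using ShA_surj[of "Neg C g" X Y] assms Neg_in_Hom Neg_Neg by metis

lemma dist_triangle_Hom:
  assumes "dist_triangle C X Y Z f g h"
  shows "f \<in> Hom C X Y" "g \<in> Hom C Y Z" "h \<in> Hom C Z (Sh C X)"
  using assms by (auto simp: dist_triangle_def is_triangle_def)

lemma dist_triangle_rotate:
  "dist_triangle C X Y Z f g h \<Longrightarrow> dist_triangle C Y Z (Sh C X) g h (Neg C (ShA C f))"
  using TR2 unfolding dist_triangle_def by blast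

text \<open>
  The shift is only essentially surjective, so the new first object is any \<open>W\<close> with \<open>W[1] \<cong> Z\<close>. The
  arrow \<open>f\<close> is kept, which lets later arguments use both neighbours of \<open>f\<close> at once.
\<close>

lemma dist_triangle_rotate_back:
  assumes t: "dist_triangle C X Y Z f g h" and W: "W \<in> Ob C" "isomorphic C (Sh C W) Z"
  obtains w z where "dist_triangle C W X Y w f z"
proof -
  note H = dist_triangle_Hom[OF t]
  obtain c d where c: "c \<in> Hom C (Sh C W) Z" "d \<in> Hom C Z (Sh C W)"
      "d \<bullet> c = Id C (Sh C W)" "c \<bullet> d = Id C Z"
    using W isomorphicE by blast
  have X: "X \<in> Ob C" "Y \<in> Ob C" using H Hom_Ob by blast+
  have hc: "h \<bullet> c \<in> Hom C (Sh C W) (Sh C X)" using Comp_in_Hom c H by blast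
  obtain w where w: "w \<in> Hom C W X" "Neg C (ShA C w) = h \<bullet> c"
    using Neg_ShA_surj[OF hc W(1) X(1)] .
  have dg: "d \<bullet> g \<in> Hom C Y (Sh C W)" using Comp_in_Hom c H by blast
  have "dist_triangle C X Y (Sh C W) f (d \<bullet> g) (h \<bullet> c)"
  proof (rule TR1_iso[OF t])
    show "is_triangle C X Y (Sh C W) f (d \<bullet> g) (h \<bullet> c)"
      using H dg hc by (auto simp: is_triangle_def)
    show "is_iso C Z (Sh C W) d" using c by (auto simp: is_iso_def)
    show "is_iso C X X (Id C X)" "is_iso C Y Y (Id C Y)" using X is_iso_Id by auto
    show "Id C Y \<bullet> f = f \<bullet> Id C X" using H Comp_Id_left Comp_Id_right by metis
    show "d \<bullet> g = (d \<bullet> g) \<bullet> Id C Y" using dg Comp_Id_right by metis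
    show "ShA C (Id C X) \<bullet> h = (h \<bullet> c) \<bullet> d"
      using Comp_assoc[OF c(2,1) H(3)] c(4) ShA_Id[OF X(1)] H Comp_Id_left Comp_Id_right by metis
  qed
  then have "dist_triangle C W X Y w f (d \<bullet> g)"
    using TR2[of W X Y w f "d \<bullet> g"] w dg H by (simp add: is_triangle_def)
  then show ?thesis by (rule that)
qed

text \<open>
  The square given by \<open>Id\<close> and \<open>f\<close> maps the triangle \<open>X \<rightarrow> X \<rightarrow> 0\<close> to the given one, so \<open>g \<bullet> f\<close> factors
  through a zero object.
\<close>

lemma dist_triangle_Comp_Zero:
  assumes t: "dist_triangle C X Y Z f g h"
  shows "g \<bullet> f = Zero C X Z"
proof -
  note H = dist_triangle_Hom[OF t]
  have X: "X \<in> Ob C" "Y \<in> Ob C" using H Hom_Ob by blast+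
  obtain N where N: "is_zero_object C N" using ex_zero_object by blast
  obtain c where c: "c \<in> Hom C N Z" "c \<bullet> Zero C X N = g \<bullet> f"
    using TR3[OF TR1_Id[OF X(1) N] t Id_in_Hom[OF X(1)] H(1)] by blast
  then show ?thesis using Comp_Zero_right X by metis
qed

text \<open>
  Exactness of \<open>Hom(-, W)\<close>: an arrow killed by \<open>f\<close> is a morphism of the first two terms into the
  triangle \<open>V \<rightarrow> W \<rightarrow> W\<close> with \<open>V[1] \<cong> 0\<close>, whose third component is the required extension.
\<close>

lemma dist_triangle_extend:
  assumes t: "dist_triangle C X Y Z f g h" and b: "b \<in> Hom C Y W" "b \<bullet> f = Zero C X W"
  obtains c where "c \<in> Hom C Z W" "c \<bullet> g = b"
proof -
  note H = dist_triangle_Hom[OF t]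
  have Ob: "X \<in> Ob C" "W \<in> Ob C" using H b Hom_Ob by blast+
  obtain N where N: "is_zero_object C N" using ex_zero_object by blast
  obtain V where V: "V \<in> Ob C" "isomorphic C (Sh C V) N"
    using Sh_ess_surj[of N] N is_zero_object_iff by metis
  obtain v k where v: "dist_triangle C V W W v (Id C W) k"
    using dist_triangle_rotate_back[OF TR1_Id[OF Ob(2) N] V] .
  have "b \<bullet> f = v \<bullet> Zero C X V" using b Comp_Zero_right dist_triangle_Hom[OF v] Ob by metis
  then obtain c where "c \<in> Hom C Z W" "c \<bullet> g = Id C W \<bullet> b"
    using TR3[OF t v Zero_in_Hom[OF Ob(1) V(1)] b(1)] by blast
  then show ?thesis using Comp_Id_left b that by metis
qed

text \<open>
  Exactness of \<open>Hom(W, -)\<close>. The third axiom produces third components only, so both triangles are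
  rotated first: \<open>W \<rightarrow> 0 \<rightarrow> W[1]\<close> is mapped to \<open>Y \<rightarrow> Z \<rightarrow> X[1]\<close>, and the component \<open>W[1] \<rightarrow> X[1]\<close>
  is the shift of the lift.
\<close>

lemma dist_triangle_lift:
  assumes t: "dist_triangle C X Y Z f g h" and a: "a \<in> Hom C W Y" "g \<bullet> a = Zero C W Z"
  obtains a' where "a' \<in> Hom C W X" "f \<bullet> a' = a"
proof -
  note H = dist_triangle_Hom[OF t]
  have Ob: "X \<in> Ob C" "W \<in> Ob C" "Z \<in> Ob C" using H a Hom_Ob by blast+
  obtain N where N: "is_zero_object C N" using ex_zero_object by blast
  then have N': "N \<in> Ob C" by (simp add: is_zero_object_def)
  have "Zero C N Z \<bullet> Zero C W N = g \<bullet> a"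
    using a Comp_Zero_right[OF Zero_in_Hom] Ob N' by metis
  then obtain c where c: "c \<in> Hom C (Sh C W) (Sh C X)"
      "ShA C a \<bullet> Neg C (ShA C (Id C W)) = Neg C (ShA C f) \<bullet> c"
    using TR3[OF dist_triangle_rotate[OF TR1_Id[OF Ob(2) N]] dist_triangle_rotate[OF t] a(1)
        Zero_in_Hom[OF N' Ob(3)]] by blast
  obtain a' where a': "a' \<in> Hom C W X" "ShA C a' = c" using ShA_surj c Ob by blast
  have fa: "f \<bullet> a' \<in> Hom C W Y" using Comp_in_Hom a' H by blast
  have "Neg C (ShA C a) = Neg C (ShA C (f \<bullet> a'))"
  proof -
    have "ShA C a \<bullet> Neg C (ShA C (Id C W)) = Neg C (ShA C (a \<bullet> Id C W))"
      using Comp_Neg_right[OF ShA_in_Hom ShA_in_Hom] ShA_Comp a Id_in_Hom Ob by metis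
    moreover have "Neg C (ShA C f) \<bullet> ShA C a' = Neg C (ShA C (f \<bullet> a'))"
      using Comp_Neg_left[OF ShA_in_Hom ShA_in_Hom] ShA_Comp a' H by metis
    ultimately show ?thesis using c a' Comp_Id_right a by simp
  qed
  then have "ShA C a = ShA C (f \<bullet> a')" using Neg_Neg ShA_in_Hom a fa by metis
  then show ?thesis using that a' ShA_inj a fa by metis
qed

text \<open>
  From here on only the existence of a triangle on three given objects matters; arrows, and with them
  the signs of rotation, can be forgotten.
\<close>

definition triangle where
  "triangle X A Y \<longleftrightarrow> (\<exists>f g h. dist_triangle C X A Y f g h)"

lemma triangle_Ob: "triangle X A Y \<Longrightarrow> X \<in> Ob C \<and> A \<in> Ob C \<and> Y \<in> Ob C"
  unfolding triangle_def using dist_triangle_Hom Hom_Ob by meson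

lemma triangle_rotate: "triangle X A Y \<Longrightarrow> triangle A Y (Sh C X)"
  unfolding triangle_def using dist_triangle_rotate by blast

lemma triangle_rotate_back:
  "triangle X A Y \<Longrightarrow> W \<in> Ob C \<Longrightarrow> isomorphic C (Sh C W) Y \<Longrightarrow> triangle W X A"
  unfolding triangle_def using dist_triangle_rotate_back by metis

lemma triangle_hom_vanishes_left:
  assumes "triangle X A Y" "hom_vanishes C {X} {W}" "hom_vanishes C {Y} {W}" "W \<in> Ob C"
  shows "hom_vanishes C {A} {W}"
proof (rule hom_vanishes_singletonI)
  fix b assume b: "b \<in> Hom C A W"
  obtain f g h where t: "dist_triangle C X A Y f g h" using assms by (auto simp: triangle_def)
  note H = dist_triangle_Hom[OF t]
  have "b \<bullet> f = Zero C X W" using hom_vanishes_singletonD[OF assms(2)] Comp_in_Hom b H by blast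
  then obtain c where c: "c \<in> Hom C Y W" "c \<bullet> g = b" using dist_triangle_extend[OF t b] by blast
  then have "c = Zero C Y W" using hom_vanishes_singletonD[OF assms(3)] by blast
  then show "b = Zero C A W" using c Comp_Zero_left[OF H(2) assms(4)] by simp
qed (use assms triangle_Ob in blast)+

lemma triangle_hom_vanishes_right:
  assumes "triangle X A Y" "hom_vanishes C {W} {X}" "hom_vanishes C {W} {Y}" "W \<in> Ob C"
  shows "hom_vanishes C {W} {A}"
proof (rule hom_vanishes_singletonI)
  fix b assume b: "b \<in> Hom C W A"
  obtain f g h where t: "dist_triangle C X A Y f g h" using assms by (auto simp: triangle_def)
  note H = dist_triangle_Hom[OF t]
  have "g \<bullet> b = Zero C W Y" using hom_vanishes_singletonD[OF assms(3)] Comp_in_Hom b H by blast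
  then obtain c where c: "c \<in> Hom C W X" "f \<bullet> c = b" using dist_triangle_lift[OF t b] by blast
  then have "c = Zero C W X" using hom_vanishes_singletonD[OF assms(2)] by blast
  then show "b = Zero C W A" using c Comp_Zero_right[OF H(1) assms(4)] by simp
qed (use assms triangle_Ob in blast)+

text \<open>
  The identity of \<open>A\<close> dies in \<open>Y\<close>, hence lifts to \<open>X\<close>.
\<close>

lemma triangle_retract_left:
  assumes "triangle X A Y" "hom_vanishes C {A} {Y}"
  shows "retract A X"
proof -
  obtain f g h where t: "dist_triangle C X A Y f g h" using assms by (auto simp: triangle_def)
  note H = dist_triangle_Hom[OF t]
  have A: "A \<in> Ob C" using H Hom_Ob by blast
  have "g \<bullet> Id C A = Zero C A Y" using Comp_Id_right H hom_vanishes_singletonD[OF assms(2)] by metis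
  then obtain s where "s \<in> Hom C A X" "f \<bullet> s = Id C A"
    using dist_triangle_lift[OF t Id_in_Hom[OF A]] by blast
  then show ?thesis using H by (auto simp: retract_def)
qed

text \<open>
  Dually, the identity of \<open>A\<close> dies on \<open>X\<close>, hence extends along \<open>A \<rightarrow> Y\<close>.
\<close>

lemma triangle_retract_right:
  assumes "triangle X A Y" "hom_vanishes C {X} {A}"
  shows "retract A Y"
proof -
  obtain f g h where t: "dist_triangle C X A Y f g h" using assms by (auto simp: triangle_def)
  note H = dist_triangle_Hom[OF t]
  have A: "A \<in> Ob C" using H Hom_Ob by blast
  have "Id C A \<bullet> f = Zero C X A" using Comp_Id_left H hom_vanishes_singletonD[OF assms(2)] by metis
  then obtain s where "s \<in> Hom C Y A" "s \<bullet> g = Id C A"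
    using dist_triangle_extend[OF t Id_in_Hom[OF A]] by blast
  then show ?thesis using H by (auto simp: retract_def)
qed

text \<open>
  Vanishing arguments produce retracts, while the subcategories at hand are closed under direct
  summands. The complement of a retract \<open>s : A \<rightarrow> S\<close> is its cone \<open>B\<close>: as \<open>s\<close> is split, the connecting
  arrow \<open>B \<rightarrow> A[1]\<close> vanishes and \<open>S \<rightarrow> B\<close> splits too.
\<close>

lemma retract_direct_summand:
  assumes "retract A S"
  obtains B where "is_direct_sum C A B S"
proof -
  obtain s r where s: "s \<in> Hom C A S" "r \<in> Hom C S A" "r \<bullet> s = Id C A"
    using assms by (auto simp: retract_def)
  obtain B g h where t: "dist_triangle C A S B s g h" using TR1_cone s by blast
  note H = dist_triangle_Hom[OF t]
  have Ob: "A \<in> Ob C" "S \<in> Ob C" "B \<in> Ob C" "Sh C A \<in> Ob C" "Sh C S \<in> Ob C"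
    using H Hom_Ob Sh_in_Ob by blast+
  have gs: "g \<bullet> s = Zero C A B" by (rule dist_triangle_Comp_Zero[OF t])
  note t' = dist_triangle_rotate[OF t]
  \<comment> \<open>\<open>s[1] \<bullet> h = 0\<close> because the composite of adjacent arrows vanishes, and \<open>s[1]\<close> has the left inverse \<open>r[1]\<close>.\<close>
  have h0: "h = Zero C B (Sh C A)"
  proof -
    have s': "ShA C s \<in> Hom C (Sh C A) (Sh C S)" "ShA C r \<in> Hom C (Sh C S) (Sh C A)"
      using s ShA_in_Hom by blast+
    have "Neg C (ShA C s) \<bullet> h = Zero C B (Sh C S)"
      by (rule dist_triangle_Comp_Zero[OF dist_triangle_rotate[OF t']])
    then have "Neg C (ShA C s \<bullet> h) = Zero C B (Sh C S)" using Comp_Neg_left[OF H(3) s'(1)] by simp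
    then have "ShA C s \<bullet> h = Zero C B (Sh C S)"
      using Add_Neg[OF Comp_in_Hom[OF H(3) s'(1)]] Add_Zero[OF Comp_in_Hom[OF H(3) s'(1)]] by simp
    then have "ShA C r \<bullet> (ShA C s \<bullet> h) = Zero C B (Sh C A)" using Comp_Zero_right s' Ob by metis
    moreover have "ShA C r \<bullet> ShA C s = Id C (Sh C A)" using ShA_Comp[OF s(1,2)] s ShA_Id Ob by simp
    ultimately show ?thesis using Comp_assoc[OF H(3) s'] Comp_Id_left[OF H(3)] by simp
  qed
  then have "h \<bullet> Id C B = Zero C B (Sh C A)" using Comp_Id_right H by metis
  then obtain t where t1: "t \<in> Hom C B S" "g \<bullet> t = Id C B"
    using dist_triangle_lift[OF t' Id_in_Hom[OF Ob(3)]] by blast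
  have sr: "s \<bullet> r \<in> Hom C S S" using s Comp_in_Hom by blast
  \<comment> \<open>The idempotent complementary to \<open>s \<bullet> r\<close>; it kills \<open>s\<close> and so factors through \<open>B\<close> as \<open>d \<bullet> g\<close>.
    The section \<open>t\<close> serves only to cancel \<open>g\<close> on the right.\<close>
  define e where "e = Id C S \<boxplus> Neg C (s \<bullet> r)"
  have e: "e \<in> Hom C S S" unfolding e_def using Add_in_Hom Id_in_Hom Neg_in_Hom sr Ob by blast
  note ids = Id_in_Hom[OF Ob(2)] and nsr = Neg_in_Hom[OF sr]
  have "s \<bullet> (r \<bullet> s) = s" using s Comp_Id_right by simp
  then have srs: "(s \<bullet> r) \<bullet> s = s" using Comp_assoc[OF s(1,2,1)] by simp
  have "e \<bullet> s = Zero C A S"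
    unfolding e_def using Comp_Add_left[OF s(1) ids nsr] Comp_Neg_left[OF s(1) sr] srs
      Comp_Id_left[OF s(1)] Add_Neg[OF s(1)] by simp
  then obtain d where d: "d \<in> Hom C B S" "d \<bullet> g = e" using dist_triangle_extend[OF t e] by blast
  have "r \<bullet> (s \<bullet> r) = r" using Comp_assoc[OF s(2,1,2)] s Comp_Id_left[OF s(2)] by simp
  then have re: "r \<bullet> e = Zero C S A"
    unfolding e_def using Comp_Add_right[OF ids nsr s(2)] Comp_Neg_right[OF sr s(2)]
      Comp_Id_right[OF s(2)] Add_Neg[OF s(2)] by simp
  have "g \<bullet> (s \<bullet> r) = Zero C S B"
    using Comp_assoc[OF s(2,1) H(2)] gs Comp_Zero_left[OF s(2) Ob(3)] by simp
  then have "g \<bullet> Neg C (s \<bullet> r) = Zero C S B"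
    using Comp_Neg_right[OF sr H(2)] Neg_unique[of "Zero C S B" S B "Zero C S B"] Zero_in_Hom Ob
      Zero_Add by metis
  then have ge: "g \<bullet> e = g"
    unfolding e_def using Comp_Add_right[OF ids nsr H(2)] Comp_Id_right[OF H(2)] Add_Zero[OF H(2)] by simp
  have rd: "r \<bullet> d = Zero C B A"
  proof -
    have rd: "r \<bullet> d \<in> Hom C B A" using Comp_in_Hom d s by blast
    have "(r \<bullet> d) \<bullet> g = Zero C S A" using Comp_assoc[OF H(2) d(1) s(2)] d re by simp
    then have "((r \<bullet> d) \<bullet> g) \<bullet> t = Zero C B A" using Comp_Zero_left t1 Ob by metis
    then show ?thesis using Comp_assoc[OF t1(1) H(2) rd] t1 Comp_Id_right[OF rd] by simp
  qed
  have gd: "g \<bullet> d = Id C B"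
  proof -
    have gd: "g \<bullet> d \<in> Hom C B B" using Comp_in_Hom d H by blast
    have "(g \<bullet> d) \<bullet> g = g" using Comp_assoc[OF H(2) d(1) H(2)] d ge by simp
    then have "((g \<bullet> d) \<bullet> g) \<bullet> t = Id C B" using t1 by simp
    then show ?thesis using Comp_assoc[OF t1(1) H(2) gd] t1 Comp_Id_right[OF gd] by simp
  qed
  have "s \<bullet> r \<boxplus> d \<bullet> g = Id C S"
  proof -
    have "s \<bullet> r \<boxplus> e = e \<boxplus> s \<bullet> r" using Add_commute sr e by blast
    also have "\<dots> = Id C S \<boxplus> (Neg C (s \<bullet> r) \<boxplus> s \<bullet> r)" unfolding e_def by (rule Add_assoc[OF ids nsr sr])
    also have "Neg C (s \<bullet> r) \<boxplus> s \<bullet> r = Zero C S S" using Add_Neg[OF sr] Add_commute[OF sr nsr] by simp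
    finally show ?thesis using Add_Zero[OF ids] d by simp
  qed
  then have "is_direct_sum C A B S"
    unfolding is_direct_sum_def using Ob s H d rd gd gs by blast
  then show ?thesis by (rule that)
qed

text \<open>
  The arrow \<open>f\<close> has a right inverse, because the next arrow vanishes, and a left inverse, because the
  preceding object in the rotated triangle vanishes.
\<close>

lemma triangle_zero_right:
  assumes "triangle X A N" "is_zero_object C N"
  shows "isomorphic C X A"
proof -
  obtain f g h where t: "dist_triangle C X A N f g h" using assms by (auto simp: triangle_def)
  note H = dist_triangle_Hom[OF t]
  have Ob: "X \<in> Ob C" "A \<in> Ob C" using H Hom_Ob by blast+
  have N: "N \<in> Ob C" "Id C N = Zero C N N" using assms is_zero_object_iff by auto
  have "g \<bullet> Id C A = Zero C A N"
    using Comp_Id_right H hom_vanishes_singletonD[OF hom_vanishes_singleton_Id(2)[OF N Ob(2)]] by metis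
  then obtain s where s: "s \<in> Hom C A X" "f \<bullet> s = Id C A"
    using dist_triangle_lift[OF t Id_in_Hom[OF Ob(2)]] by blast
  obtain V where V: "V \<in> Ob C" "isomorphic C (Sh C V) N" using Sh_ess_surj N by blast
  have "Id C V = Zero C V V"
  proof -
    have "hom_vanishes C {Sh C V} {Sh C V}"
      using retract_hom_vanishes_left[OF isomorphic_retract[OF V(2)]]
        hom_vanishes_singleton_Id(1)[OF N] Sh_in_Ob V by blast
    then have "ShA C (Id C V) = ShA C (Zero C V V)"
      using ShA_Id ShA_Zero V Id_in_Hom Sh_in_Ob hom_vanishes_singletonD by metis
    then show ?thesis using ShA_inj Id_in_Hom Zero_in_Hom V by metis
  qed
  note V0 = hom_vanishes_singleton_Id(1)[OF V(1) this Ob(1)]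
  obtain w z where t': "dist_triangle C V X A w f z" using dist_triangle_rotate_back[OF t V] .
  have "Id C X \<bullet> w = Zero C V X"
    using Comp_Id_left dist_triangle_Hom(1)[OF t'] hom_vanishes_singletonD[OF V0] by metis
  then obtain c where c: "c \<in> Hom C A X" "c \<bullet> f = Id C X"
    using dist_triangle_extend[OF t' Id_in_Hom[OF Ob(1)]] by blast
  have "c = s" using Comp_assoc[OF s(1) H(1) c(1)] s c Comp_Id_left[OF s(1)] Comp_Id_right[OF c(1)] by simp
  then show ?thesis unfolding isomorphic_def is_iso_def using H s c by blast
qed

lemma is_zero_object_Sh: "is_zero_object C N \<Longrightarrow> is_zero_object C (Sh C N)"
  using is_zero_object_iff ShA_Id ShA_Zero Sh_in_Ob by metis

lemma triangle_zero_left: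
  assumes "triangle N A Y" "is_zero_object C N"
  shows "isomorphic C A Y"
  using triangle_zero_right[OF triangle_rotate[OF assms(1)] is_zero_object_Sh[OF assms(2)]] .

lemma triangle_zeroI:
  assumes "X \<in> Ob C" "is_zero_object C N"
  shows "triangle X X N" "triangle N X X"
proof -
  have r: "triangle X X M" if "is_zero_object C M" for M
    unfolding triangle_def using TR1_Id[OF assms(1) that] by blast
  show "triangle X X N" using r assms(2) .
  have N: "N \<in> Ob C" using assms by (simp add: is_zero_object_def)
  show "triangle N X X"
    using triangle_rotate_back[OF r[OF is_zero_object_Sh[OF assms(2)]] N]
      isomorphic_refl Sh_in_Ob N by blast
qed

section \<open>Shifts\<close>

lemma triangle_iso:
  assumes t: "triangle X A Y" and "isomorphic C X X'" "isomorphic C A A'" "isomorphic C Y Y'"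
  shows "triangle X' A' Y'"
proof -
  obtain f g h where t: "dist_triangle C X A Y f g h" using assms by (auto simp: triangle_def)
  note H = dist_triangle_Hom[OF t]
  obtain a a' where a: "a \<in> Hom C X X'" "a' \<in> Hom C X' X" "a' \<bullet> a = Id C X" "a \<bullet> a' = Id C X'"
    using assms isomorphicE by blast
  obtain b b' where b: "b \<in> Hom C A A'" "b' \<in> Hom C A' A" "b' \<bullet> b = Id C A" "b \<bullet> b' = Id C A'"
    using assms isomorphicE by blast
  obtain c c' where c: "c \<in> Hom C Y Y'" "c' \<in> Hom C Y' Y" "c' \<bullet> c = Id C Y" "c \<bullet> c' = Id C Y'"
    using assms isomorphicE by blast
  have Sa: "ShA C a \<in> Hom C (Sh C X) (Sh C X')" using ShA_in_Hom a by blast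
  have bf: "b \<bullet> f \<in> Hom C X A'" and cg: "c \<bullet> g \<in> Hom C A Y'"
    and ah: "ShA C a \<bullet> h \<in> Hom C Y (Sh C X')" using Comp_in_Hom H a b c Sa by blast+
  have "dist_triangle C X' A' Y' ((b \<bullet> f) \<bullet> a') ((c \<bullet> g) \<bullet> b') ((ShA C a \<bullet> h) \<bullet> c')"
  proof (rule TR1_iso[OF t])
    show "is_iso C X X' a" "is_iso C A A' b" "is_iso C Y Y' c" using a b c by (auto simp: is_iso_def)
    show "is_triangle C X' A' Y' ((b \<bullet> f) \<bullet> a') ((c \<bullet> g) \<bullet> b') ((ShA C a \<bullet> h) \<bullet> c')"
      unfolding is_triangle_def using Comp_in_Hom a b c bf cg ah by blast
    show "b \<bullet> f = ((b \<bullet> f) \<bullet> a') \<bullet> a" using Comp_assoc[OF a(1,2) bf] a Comp_Id_right bf by metis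
    show "c \<bullet> g = ((c \<bullet> g) \<bullet> b') \<bullet> b" using Comp_assoc[OF b(1,2) cg] b Comp_Id_right cg by metis
    show "ShA C a \<bullet> h = ((ShA C a \<bullet> h) \<bullet> c') \<bullet> c" using Comp_assoc[OF c(1,2) ah] c Comp_Id_right ah by metis
  qed
  then show ?thesis unfolding triangle_def by blast
qed

text \<open>
  Three rotations turn \<open>(f, g, h)\<close> into the negatives of \<open>(f[1], g[1], h[1])\<close>. Since every arrow between
  shifts is the negative of a shifted arrow, the sign costs nothing and the argument can be reversed.
\<close>

lemma triangle_Sh_iff:
  assumes Ob: "X \<in> Ob C" "A \<in> Ob C" "Y \<in> Ob C"
  shows "triangle (Sh C X) (Sh C A) (Sh C Y) \<longleftrightarrow> triangle X A Y"
proof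
  assume "triangle (Sh C X) (Sh C A) (Sh C Y)"
  then obtain f' g' h' where t: "dist_triangle C (Sh C X) (Sh C A) (Sh C Y) f' g' h'"
    by (auto simp: triangle_def)
  note H = dist_triangle_Hom[OF t]
  obtain f where f: "f \<in> Hom C X A" "Neg C (ShA C f) = f'" using Neg_ShA_surj H Ob by blast
  obtain g where g: "g \<in> Hom C A Y" "Neg C (ShA C g) = g'" using Neg_ShA_surj H Ob by blast
  obtain h where h: "h \<in> Hom C Y (Sh C X)" "Neg C (ShA C h) = h'"
    using Neg_ShA_surj[OF H(3) Ob(3) Sh_in_Ob[OF Ob(1)]] by blast
  have "dist_triangle C Y (Sh C X) (Sh C A) h f' g'"
    using TR2[of Y "Sh C X" "Sh C A" h f' g'] t h H by (simp add: is_triangle_def)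
  then have "dist_triangle C A Y (Sh C X) g h f'"
    using TR2[of A Y "Sh C X" g h f'] g h H by (simp add: is_triangle_def)
  then have "dist_triangle C X A Y f g h"
    using TR2[of X A Y f g h] f g h H by (simp add: is_triangle_def)
  then show "triangle X A Y" by (auto simp: triangle_def)
qed (use triangle_rotate in blast)

lemma hom_vanishes_Sh_iff:
  assumes Ob: "X \<in> Ob C" "Y \<in> Ob C"
  shows "hom_vanishes C {Sh C X} {Sh C Y} \<longleftrightarrow> hom_vanishes C {X} {Y}"
proof
  assume *: "hom_vanishes C {Sh C X} {Sh C Y}"
  show "hom_vanishes C {X} {Y}"
    using hom_vanishes_singletonD[OF *] ShA_inj ShA_in_Hom ShA_Zero Zero_in_Hom Ob
    by (intro hom_vanishes_singletonI) metis+
next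
  assume *: "hom_vanishes C {X} {Y}"
  show "hom_vanishes C {Sh C X} {Sh C Y}"
    using hom_vanishes_singletonD[OF *] ShA_surj ShA_Zero Ob Sh_in_Ob
    by (intro hom_vanishes_singletonI) metis+
qed

lemma retract_Sh_iff:
  assumes Ob: "X \<in> Ob C" "Y \<in> Ob C"
  shows "retract (Sh C X) (Sh C Y) \<longleftrightarrow> retract X Y"
proof
  assume "retract (Sh C X) (Sh C Y)"
  then obtain i p where "i \<in> Hom C (Sh C X) (Sh C Y)" "p \<in> Hom C (Sh C Y) (Sh C X)" "p \<bullet> i = Id C (Sh C X)"
    by (auto simp: retract_def)
  then obtain i' p' where *: "i' \<in> Hom C X Y" "p' \<in> Hom C Y X" "ShA C p' \<bullet> ShA C i' = Id C (Sh C X)"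
    using ShA_surj Ob by metis
  then have "p' \<bullet> i' = Id C X" using ShA_inj[of "p' \<bullet> i'" X X "Id C X"] ShA_Comp ShA_Id Comp_in_Hom Id_in_Hom Ob by metis
  then show "retract X Y" using * by (auto simp: retract_def)
next
  assume "retract X Y"
  then show "retract (Sh C X) (Sh C Y)"
    unfolding retract_def using ShA_in_Hom ShA_Comp ShA_Id Ob by metis
qed

lemma isomorphic_Sh_iff:
  assumes Ob: "X \<in> Ob C" "Y \<in> Ob C"
  shows "isomorphic C (Sh C X) (Sh C Y) \<longleftrightarrow> isomorphic C X Y"
proof
  assume "isomorphic C (Sh C X) (Sh C Y)"
  then obtain i p where "i \<in> Hom C (Sh C X) (Sh C Y)" "p \<in> Hom C (Sh C Y) (Sh C X)"
      "p \<bullet> i = Id C (Sh C X)" "i \<bullet> p = Id C (Sh C Y)"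
    using isomorphicE by blast
  then obtain i' p' where *: "i' \<in> Hom C X Y" "p' \<in> Hom C Y X" "ShA C p' \<bullet> ShA C i' = Id C (Sh C X)"
      "ShA C i' \<bullet> ShA C p' = Id C (Sh C Y)"
    using ShA_surj Ob by metis
  have "ShA C (p' \<bullet> i') = ShA C (Id C X)" "ShA C (i' \<bullet> p') = ShA C (Id C Y)"
    using * ShA_Comp[OF *(1,2)] ShA_Comp[OF *(2,1)] ShA_Id Ob by simp_all
  then have "p' \<bullet> i' = Id C X" "i' \<bullet> p' = Id C Y"
    using ShA_inj[OF Comp_in_Hom[OF *(1,2)] Id_in_Hom[OF Ob(1)]]
      ShA_inj[OF Comp_in_Hom[OF *(2,1)] Id_in_Hom[OF Ob(2)]] by simp_all
  then show "isomorphic C X Y" using * by (auto simp: isomorphic_def is_iso_def)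
next
  assume "isomorphic C X Y"
  then show "isomorphic C (Sh C X) (Sh C Y)" unfolding isomorphic_def using is_iso_ShA by blast
qed

lemma Sh_pow_Ob: "X \<in> Ob C \<Longrightarrow> (Sh C ^^ n) X \<in> Ob C"
  by (induction n) (auto simp: Sh_in_Ob)

lemma isomorphic_Sh_pow_iff:
  "X \<in> Ob C \<Longrightarrow> Y \<in> Ob C \<Longrightarrow> isomorphic C ((Sh C ^^ n) X) ((Sh C ^^ n) Y) \<longleftrightarrow> isomorphic C X Y"
  by (induction n) (auto simp: isomorphic_Sh_iff Sh_pow_Ob)

lemma ex_Sh_pow_preimage:
  "Y \<in> Ob C \<Longrightarrow> \<exists>X \<in> Ob C. isomorphic C ((Sh C ^^ n) X) Y"
proof (induction n arbitrary: Y)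
  case 0
  then show ?case using isomorphic_refl by auto
next
  case (Suc n)
  obtain Z where Z: "Z \<in> Ob C" "isomorphic C (Sh C Z) Y" using Sh_ess_surj Suc by blast
  obtain X where X: "X \<in> Ob C" "isomorphic C ((Sh C ^^ n) X) Z" using Suc Z by blast
  have "isomorphic C (Sh C ((Sh C ^^ n) X)) (Sh C Z)"
    using isomorphic_Sh_iff Sh_pow_Ob X Z by blast
  then show ?case using X Z isomorphic_trans by auto
qed

text \<open>
  The relation \<open>B \<cong> A[n]\<close> for an integer \<open>n\<close>, with the same encoding of negative exponents as in
  \<open>shift_sub\<close>.
\<close>

definition is_shift where
  "is_shift n A B \<longleftrightarrow> A \<in> Ob C \<and> B \<in> Ob C \<and>
     isomorphic C ((Sh C ^^ nat (- n)) B) ((Sh C ^^ nat n) A)"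

lemma is_shift_Ob: "is_shift n A B \<Longrightarrow> A \<in> Ob C \<and> B \<in> Ob C"
  by (simp add: is_shift_def)

text \<open>
  As the shift is fully faithful, a common power of it can be added to or cancelled from both sides, so
  only the difference of the two exponents matters. This makes shifts compose.
\<close>

lemma is_shift_iff:
  assumes "A \<in> Ob C" "B \<in> Ob C" "int p - int q = n"
  shows "is_shift n A B \<longleftrightarrow> isomorphic C ((Sh C ^^ q) B) ((Sh C ^^ p) A)"
proof -
  define k where "k = min p q"
  have "p = k + nat n" "q = k + nat (- n)" using assms(3) by (auto simp: k_def)
  then show ?thesis
    using isomorphic_Sh_pow_iff[of "(Sh C ^^ nat (- n)) B" "(Sh C ^^ nat n) A" k] assms
    by (simp add: is_shift_def Sh_pow_Ob funpow_add)
qed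

lemma is_shift_trans:
  assumes "is_shift a A B" "is_shift b B D"
  shows "is_shift (a + b) A D"
proof -
  let ?p = "nat a" and ?q = "nat (- a)" and ?r = "nat b" and ?s = "nat (- b)"
  have Ob: "A \<in> Ob C" "B \<in> Ob C" "D \<in> Ob C" using assms is_shift_Ob by blast+
  have 1: "isomorphic C ((Sh C ^^ ?q) ((Sh C ^^ ?s) D)) ((Sh C ^^ ?q) ((Sh C ^^ ?r) B))"
    using assms Ob by (simp add: is_shift_def isomorphic_Sh_pow_iff Sh_pow_Ob)
  have 2: "isomorphic C ((Sh C ^^ ?r) ((Sh C ^^ ?q) B)) ((Sh C ^^ ?r) ((Sh C ^^ ?p) A))"
    using assms Ob by (simp add: is_shift_def isomorphic_Sh_pow_iff Sh_pow_Ob)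
  have "(Sh C ^^ ?q) ((Sh C ^^ ?r) B) = (Sh C ^^ ?r) ((Sh C ^^ ?q) B)"
    by (metis add.commute comp_apply funpow_add)
  then have "isomorphic C ((Sh C ^^ ?q) ((Sh C ^^ ?s) D)) ((Sh C ^^ ?r) ((Sh C ^^ ?p) A))"
    using isomorphic_trans[OF 1] 2 by simp
  then have "isomorphic C ((Sh C ^^ (?q + ?s)) D) ((Sh C ^^ (?r + ?p)) A)"
    by (simp only: funpow_add comp_apply)
  then show ?thesis by (subst is_shift_iff) (use Ob in auto)
qed

lemma is_shift_sym: "is_shift n A B \<Longrightarrow> is_shift (- n) B A"
  using isomorphic_sym by (simp add: is_shift_def)

lemma is_shift_0: "is_shift 0 A B \<longleftrightarrow> isomorphic C A B"
  using isomorphic_Ob isomorphic_sym by (auto simp: is_shift_def)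

lemma is_shift_Sh: "A \<in> Ob C \<Longrightarrow> is_shift 1 A (Sh C A)"
  by (simp add: is_shift_def isomorphic_refl Sh_in_Ob)

lemma is_shift_minus_1: "is_shift (- 1) A B \<Longrightarrow> isomorphic C (Sh C B) A"
  by (simp add: is_shift_def)

lemma ex_is_shift:
  assumes "A \<in> Ob C"
  obtains B where "is_shift n A B"
proof -
  obtain B where "B \<in> Ob C" "isomorphic C ((Sh C ^^ nat (- n)) B) ((Sh C ^^ nat n) A)"
    using ex_Sh_pow_preimage Sh_pow_Ob assms by metis
  then show ?thesis using that assms by (simp add: is_shift_def)
qed

text \<open>
  Shifting by an arbitrary integer reduces to invariance under isomorphism and under a single shift.
  A predicate on two objects is passed as a ternary one that ignores its second argument.
\<close>

lemma is_shift_invariant: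
  assumes iso: "\<And>X A Y X' A' Y'. P X A Y \<Longrightarrow> isomorphic C X X' \<Longrightarrow> isomorphic C A A' \<Longrightarrow>
      isomorphic C Y Y' \<Longrightarrow> P X' A' Y'"
    and Sh: "\<And>X A Y. X \<in> Ob C \<Longrightarrow> A \<in> Ob C \<Longrightarrow> Y \<in> Ob C \<Longrightarrow>
      P (Sh C X) (Sh C A) (Sh C Y) \<longleftrightarrow> P X A Y"
    and sh: "is_shift n X X'" "is_shift n A A'" "is_shift n Y Y'"
    and P: "P X A Y"
  shows "P X' A' Y'"
proof -
  have pow: "P ((Sh C ^^ k) X) ((Sh C ^^ k) A) ((Sh C ^^ k) Y) \<longleftrightarrow> P X A Y"
    if "X \<in> Ob C" "A \<in> Ob C" "Y \<in> Ob C" for X A Y k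
    using that by (induction k) (auto simp: Sh Sh_pow_Ob)
  note Ob = sh[THEN is_shift_Ob]
  have "P ((Sh C ^^ nat n) X) ((Sh C ^^ nat n) A) ((Sh C ^^ nat n) Y)"
    using pow P Ob by blast
  then have "P ((Sh C ^^ nat (- n)) X') ((Sh C ^^ nat (- n)) A') ((Sh C ^^ nat (- n)) Y')"
    using iso isomorphic_sym sh unfolding is_shift_def by meson
  then show ?thesis using pow Ob by blast
qed

lemma is_shift_triangle:
  assumes "triangle X A Y" "is_shift n X X'" "is_shift n A A'" "is_shift n Y Y'"
  shows "triangle X' A' Y'"
  using is_shift_invariant[where P = triangle, OF triangle_iso triangle_Sh_iff assms(2-4,1)] .

lemma is_shift_retract:
  assumes "retract X Y" "is_shift n X X'" "is_shift n Y Y'"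
  shows "retract X' Y'"
proof (rule is_shift_invariant[where P = "\<lambda>X A Y. retract X Y", OF _ _ assms(2) assms(2) assms(3) assms(1)])
  fix X A Y X' A' Y'
  assume "retract X Y" "isomorphic C X X'" "isomorphic C Y Y'"
  then show "retract X' Y'" by (meson isomorphic_retract isomorphic_sym retract_trans)
qed (rule retract_Sh_iff)

lemma is_shift_hom_vanishes:
  assumes "hom_vanishes C {X} {Y}" "is_shift n X X'" "is_shift n Y Y'"
  shows "hom_vanishes C {X'} {Y'}"
proof (rule is_shift_invariant[where P = "\<lambda>X A Y. hom_vanishes C {X} {Y}",
      OF _ _ assms(2) assms(2) assms(3) assms(1)])
  fix X A Y X' A' Y'
  assume h: "hom_vanishes C {X} {Y}" and i: "isomorphic C X X'" "isomorphic C Y Y'"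
  have Ob: "X' \<in> Ob C" "Y \<in> Ob C" using i isomorphic_Ob by blast+
  have "hom_vanishes C {X'} {Y}"
    using retract_hom_vanishes_left[OF isomorphic_retract[OF isomorphic_sym[OF i(1)]] h Ob(2)] .
  then show "hom_vanishes C {X'} {Y'}"
    using retract_hom_vanishes_right[OF isomorphic_retract[OF isomorphic_sym[OF i(2)]] _ Ob(1)] by blast
qed (rule hom_vanishes_Sh_iff)

lemma octahedral_cone:
  assumes "triangle X A Y" "triangle A B Z"
  obtains K where "triangle X B K" "triangle Y K Z"
proof -
  obtain f g h where t: "dist_triangle C X A Y f g h" using assms by (auto simp: triangle_def)
  obtain f' g' h' where t': "dist_triangle C A B Z f' g' h'" using assms by (auto simp: triangle_def)
  have "f' \<bullet> f \<in> Hom C X B" using Comp_in_Hom dist_triangle_Hom t t' by blast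
  then obtain K k l where "dist_triangle C X B K (f' \<bullet> f) k l" using TR1_cone by blast
  then show ?thesis using that TR4_octahedral[OF t t'] unfolding triangle_def by blast
qed

text \<open>
  The octahedral axiom speaks about cones of composites. Rotating both triangles makes the two given
  arrows composable, and the resulting triangle of shifted objects is shifted back.
\<close>

lemma octahedral_cocone:
  assumes "triangle X B K" "triangle Y K Z"
  obtains A where "triangle X A Y" "triangle A B Z"
proof -
  obtain K' where K': "triangle B Z K'" "triangle (Sh C X) K' (Sh C Y)"
    using octahedral_cone[OF triangle_rotate[OF assms(1)] triangle_rotate[OF assms(2)]] .
  obtain A where A: "A \<in> Ob C" "isomorphic C (Sh C A) K'" using Sh_ess_surj triangle_Ob K' by blast
  have Ob: "X \<in> Ob C" "Y \<in> Ob C" using assms triangle_Ob by blast+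
  have "triangle (Sh C X) (Sh C A) (Sh C Y)"
    using triangle_iso[OF K'(2)] A isomorphic_refl isomorphic_sym Sh_in_Ob Ob by blast
  then have "triangle X A Y" using triangle_Sh_iff A Ob by blast
  moreover have "triangle A B Z" using triangle_rotate_back K' A by blast
  ultimately show ?thesis by (rule that)
qed

section \<open>Operations on subcategories\<close>

lemma subcategory_Ob: "subcategory C U \<Longrightarrow> X \<in> U \<Longrightarrow> X \<in> Ob C"
  unfolding subcategory_def by blast

lemma subcategory_iso: "subcategory C U \<Longrightarrow> X \<in> U \<Longrightarrow> isomorphic C X Y \<Longrightarrow> Y \<in> U"
  unfolding subcategory_def by blast

lemma subcategory_Int: "subcategory C U \<Longrightarrow> subcategory C V \<Longrightarrow> subcategory C (U \<inter> V)"
  unfolding subcategory_def by blast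

lemma hom_vanishesI: "(\<And>X Y. X \<in> U \<Longrightarrow> Y \<in> V \<Longrightarrow> hom_vanishes C {X} {Y}) \<Longrightarrow> hom_vanishes C U V"
  by (simp add: hom_vanishes_def)

lemma hom_vanishesD: "hom_vanishes C U V \<Longrightarrow> X \<in> U \<Longrightarrow> Y \<in> V \<Longrightarrow> hom_vanishes C {X} {Y}"
  by (simp add: hom_vanishes_def)

lemma hom_vanishes_mono: "hom_vanishes C U V \<Longrightarrow> U' \<subseteq> U \<Longrightarrow> V' \<subseteq> V \<Longrightarrow> hom_vanishes C U' V'"
  unfolding hom_vanishes_def by blast

lemma mem_star: "A \<in> star C U V \<longleftrightarrow> (\<exists>X \<in> U. \<exists>Y \<in> V. triangle X A Y)"
  unfolding star_def triangle_def[symmetric] using triangle_Ob by blast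

lemma starI: "X \<in> U \<Longrightarrow> Y \<in> V \<Longrightarrow> triangle X A Y \<Longrightarrow> A \<in> star C U V"
  using mem_star by blast

lemma starE:
  assumes "A \<in> star C U V"
  obtains X Y where "X \<in> U" "Y \<in> V" "triangle X A Y"
  using assms mem_star by blast

lemma star_mono: "U \<subseteq> U' \<Longrightarrow> V \<subseteq> V' \<Longrightarrow> star C U V \<subseteq> star C U' V'"
  unfolding star_def by blast

lemma star_Ob: "star C U V \<subseteq> Ob C"
  unfolding star_def by blast

lemma subcategory_star: "subcategory C (star C U V)"
  unfolding subcategory_def
proof (intro conjI star_Ob allI impI, elim conjE)
  fix A B assume A: "A \<in> star C U V" and i: "isomorphic C A B"
  obtain X Y where t: "X \<in> U" "Y \<in> V" "triangle X A Y" using starE[OF A] .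
  have "triangle X B Y"
    using triangle_iso[OF t(3) _ i] isomorphic_refl triangle_Ob[OF t(3)] by blast
  then show "B \<in> star C U V" using t mem_star by blast
qed

text \<open>
  The two inclusions are the octahedral axiom in its two forms.
\<close>

lemma star_assoc: "star C (star C U V) W = star C U (star C V W)"
proof (intro equalityI subsetI)
  fix B assume "B \<in> star C (star C U V) W"
  then obtain X A Y Z where *: "X \<in> U" "Y \<in> V" "Z \<in> W" "triangle X A Y" "triangle A B Z"
    unfolding mem_star Bex_def by blast
  obtain K where "triangle X B K" "triangle Y K Z" using octahedral_cone[OF *(4,5)] .
  then show "B \<in> star C U (star C V W)" unfolding mem_star Bex_def using * by blast
next
  fix B assume "B \<in> star C U (star C V W)"
  then obtain X K Y Z where *: "X \<in> U" "Y \<in> V" "Z \<in> W" "triangle X B K" "triangle Y K Z"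
    unfolding mem_star Bex_def by blast
  obtain A where "triangle X A Y" "triangle A B Z" using octahedral_cocone[OF *(4,5)] .
  then show "B \<in> star C (star C U V) W" unfolding mem_star Bex_def using * by blast
qed

lemma hom_vanishes_star_left:
  assumes "hom_vanishes C U W" "hom_vanishes C V W" "W \<subseteq> Ob C"
  shows "hom_vanishes C (star C U V) W"
proof (rule hom_vanishesI)
  fix A Z assume A: "A \<in> star C U V" and Z: "Z \<in> W"
  obtain X Y where t: "X \<in> U" "Y \<in> V" "triangle X A Y" using starE[OF A] .
  show "hom_vanishes C {A} {Z}"
    using triangle_hom_vanishes_left[OF t(3) hom_vanishesD[OF assms(1) t(1) Z]
        hom_vanishesD[OF assms(2) t(2) Z]] assms(3) Z by blast
qed

lemma hom_vanishes_star_right: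
  assumes "hom_vanishes C W U" "hom_vanishes C W V" "W \<subseteq> Ob C"
  shows "hom_vanishes C W (star C U V)"
proof (rule hom_vanishesI)
  fix A Z assume A: "A \<in> star C U V" and Z: "Z \<in> W"
  obtain X Y where t: "X \<in> U" "Y \<in> V" "triangle X A Y" using starE[OF A] .
  show "hom_vanishes C {Z} {A}"
    using triangle_hom_vanishes_right[OF t(3) hom_vanishesD[OF assms(1) Z t(1)]
        hom_vanishesD[OF assms(2) Z t(2)]] assms(3) Z by blast
qed

lemma mem_shift_sub: "U \<subseteq> Ob C \<Longrightarrow> B \<in> shift_sub C U n \<longleftrightarrow> (\<exists>A \<in> U. is_shift n A B)"
  unfolding shift_sub_def is_shift_def by blast

lemma shift_subE:
  assumes "B \<in> shift_sub C U n" "subcategory C U"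
  obtains A where "A \<in> U" "is_shift n A B"
  using assms unfolding subcategory_def by (metis mem_shift_sub)

lemma shift_subI: "A \<in> U \<Longrightarrow> is_shift n A B \<Longrightarrow> B \<in> shift_sub C U n"
  unfolding shift_sub_def is_shift_def by blast

lemma is_shift_mem_iff:
  assumes U: "subcategory C U" and s: "is_shift n A B"
  shows "B \<in> shift_sub C U n \<longleftrightarrow> A \<in> U"
proof
  assume "B \<in> shift_sub C U n"
  then obtain A' where A': "A' \<in> U" "is_shift n A' B"
    using shift_subE[OF _ U] by blast
  have "is_shift (n + - n) A' A" using is_shift_trans[OF A'(2) is_shift_sym[OF s]] .
  then have "isomorphic C A' A" by (simp add: is_shift_0)
  then show "A \<in> U" using subcategory_iso[OF U A'(1)] by blast
next
  assume "A \<in> U"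
  then show "B \<in> shift_sub C U n" using shift_subI s by blast
qed

lemma shift_sub_Ob: "shift_sub C U n \<subseteq> Ob C"
  unfolding shift_sub_def by blast

lemma subcategory_shift_sub:
  assumes "subcategory C U"
  shows "subcategory C (shift_sub C U n)"
  unfolding subcategory_def
proof (intro conjI shift_sub_Ob allI impI, elim conjE)
  fix A B assume A: "A \<in> shift_sub C U n" and i: "isomorphic C A B"
  obtain X where X: "X \<in> U" "is_shift n X A" using shift_subE[OF A assms] .
  have "is_shift (n + 0) X B" using is_shift_trans X i is_shift_0 by blast
  then show "B \<in> shift_sub C U n" using is_shift_mem_iff[OF assms] X by simp
qed

lemma shift_sub_add:
  assumes "subcategory C U"
  shows "shift_sub C (shift_sub C U a) b = shift_sub C U (a + b)"
proof -
  have "B \<in> shift_sub C (shift_sub C U a) b \<longleftrightarrow> B \<in> shift_sub C U (a + b)" if B: "B \<in> Ob C" for B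
  proof -
    obtain A where A: "is_shift (- b) B A" using ex_is_shift[OF B] .
    then have sA: "is_shift b A B" using is_shift_sym by fastforce
    obtain X where X: "is_shift (- a) A X" using ex_is_shift is_shift_Ob[OF A] by blast
    then have sX: "is_shift a X A" using is_shift_sym by fastforce
    show ?thesis
      using is_shift_mem_iff[OF subcategory_shift_sub[OF assms] sA] is_shift_mem_iff[OF assms sX]
        is_shift_mem_iff[OF assms is_shift_trans[OF sX sA]] by simp
  qed
  then show ?thesis using shift_sub_Ob by blast
qed

lemma shift_sub_0: "subcategory C U \<Longrightarrow> shift_sub C U 0 = U"
  using is_shift_mem_iff[of U 0] is_shift_0 isomorphic_refl shift_sub_Ob subcategory_Ob by blast

lemma shift_sub_mono: "U \<subseteq> V \<Longrightarrow> shift_sub C U n \<subseteq> shift_sub C V n"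
  unfolding shift_sub_def by blast

lemma shift_sub_Int:
  assumes "subcategory C U" "subcategory C V"
  shows "shift_sub C (U \<inter> V) n = shift_sub C U n \<inter> shift_sub C V n"
proof (intro equalityI subsetI)
  fix B assume B: "B \<in> shift_sub C U n \<inter> shift_sub C V n"
  then obtain A where A: "A \<in> U" "is_shift n A B"
    using shift_subE[OF _ assms(1)] by blast
  then have "A \<in> V" using is_shift_mem_iff[OF assms(2)] B by blast
  then show "B \<in> shift_sub C (U \<inter> V) n"
    using is_shift_mem_iff[OF subcategory_Int[OF assms] A(2)] A by blast
qed (use shift_sub_mono[of "U \<inter> V" U] shift_sub_mono[of "U \<inter> V" V] in blast)

lemma shift_sub_star:
  assumes "subcategory C U" "subcategory C V"
  shows "shift_sub C (star C U V) n = star C (shift_sub C U n) (shift_sub C V n)"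
proof (intro equalityI subsetI)
  fix B assume "B \<in> shift_sub C (star C U V) n"
  then obtain A where A: "A \<in> star C U V" "is_shift n A B" using shift_subE[OF _ subcategory_star] by blast
  obtain X Y where t: "X \<in> U" "Y \<in> V" "triangle X A Y" using starE[OF A(1)] .
  obtain X' where X': "is_shift n X X'" using ex_is_shift triangle_Ob[OF t(3)] by blast
  obtain Y' where Y': "is_shift n Y Y'" using ex_is_shift triangle_Ob[OF t(3)] by blast
  have "triangle X' B Y'" using is_shift_triangle[OF t(3) X' A(2) Y'] .
  then show "B \<in> star C (shift_sub C U n) (shift_sub C V n)"
    using starI[OF shift_subI[OF t(1) X'] shift_subI[OF t(2) Y']] by blast
next
  fix B assume "B \<in> star C (shift_sub C U n) (shift_sub C V n)"
  then obtain X' Y' where t: "X' \<in> shift_sub C U n" "Y' \<in> shift_sub C V n" "triangle X' B Y'"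
    using starE by blast
  obtain X where X: "X \<in> U" "is_shift n X X'" using shift_subE[OF t(1) assms(1)] .
  obtain Y where Y: "Y \<in> V" "is_shift n Y Y'" using shift_subE[OF t(2) assms(2)] .
  obtain A where A: "is_shift (- n) B A" using ex_is_shift triangle_Ob[OF t(3)] by blast
  have "triangle X A Y" using is_shift_triangle[OF t(3) is_shift_sym[OF X(2)] A is_shift_sym[OF Y(2)]] .
  then have "A \<in> star C U V" using starI[OF X(1) Y(1)] by blast
  then show "B \<in> shift_sub C (star C U V) n"
    using is_shift_mem_iff[OF subcategory_star] is_shift_sym[OF A] by simp
qed

lemma hom_vanishes_shift_sub:
  assumes "subcategory C U" "subcategory C V" "hom_vanishes C U V"
  shows "hom_vanishes C (shift_sub C U n) (shift_sub C V n)"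
proof (rule hom_vanishesI)
  fix X' Y' assume t: "X' \<in> shift_sub C U n" "Y' \<in> shift_sub C V n"
  obtain X where X: "X \<in> U" "is_shift n X X'" using shift_subE[OF t(1) assms(1)] .
  obtain Y where Y: "Y \<in> V" "is_shift n Y Y'" using shift_subE[OF t(2) assms(2)] .
  show "hom_vanishes C {X'} {Y'}"
    using is_shift_hom_vanishes[OF hom_vanishesD[OF assms(3) X(1) Y(1)] X(2) Y(2)] .
qed

lemma Sh_mem_shift_sub: "subcategory C U \<Longrightarrow> X \<in> U \<Longrightarrow> Sh C X \<in> shift_sub C U 1"
  using is_shift_mem_iff is_shift_Sh subcategory_Ob by blast

lemma triangle_rotate_back_shift:
  assumes "triangle X A Y" "Y \<in> V" "subcategory C V"
  obtains W where "W \<in> shift_sub C V (- 1)" "triangle W X A"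
proof -
  obtain W where W: "is_shift (- 1) Y W" using ex_is_shift triangle_Ob[OF assms(1)] by blast
  then have "triangle W X A"
    using triangle_rotate_back[OF assms(1)] is_shift_Ob is_shift_minus_1 by blast
  moreover have "W \<in> shift_sub C V (- 1)" using is_shift_mem_iff[OF assms(3) W] assms by blast
  ultimately show ?thesis using that by blast
qed

text \<open>
  The closure properties common to all orthogonals, hence to the halves of a t-structure and to
  extended hearts.
\<close>

definition thick_extension_closed where
  "thick_extension_closed U \<longleftrightarrow>
     additive_subcategory C U \<and> closed_under_summands C U \<and> star C U U \<subseteq> U"

lemma summand_closed_retract:
  assumes "closed_under_summands C U" "retract A S" "S \<in> U"
  shows "A \<in> U"
  using retract_direct_summand[OF assms(2)] assms unfolding closed_under_summands_def by metis

lemma summand_closed_shift: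
  assumes "subcategory C U" "closed_under_summands C U" "retract A S" "S \<in> shift_sub C U n"
  shows "A \<in> shift_sub C U n"
proof -
  obtain S' where S': "S' \<in> U" "is_shift n S' S"
    using shift_subE[OF assms(4,1)] .
  obtain A' where A': "is_shift (- n) A A'" using ex_is_shift retract_Ob[OF assms(3)] by blast
  have "retract A' S'" using is_shift_retract[OF assms(3) A' is_shift_sym[OF S'(2)]] .
  then have "A' \<in> U" using summand_closed_retract assms S' by blast
  then show ?thesis using is_shift_mem_iff[OF assms(1), of n A' A] is_shift_sym[OF A'] by simp
qed

definition left_orth where
  "left_orth W = {X \<in> Ob C. \<forall>Y \<in> W. hom_vanishes C {X} {Y}}"

definition right_orth where
  "right_orth U = {Y \<in> Ob C. \<forall>X \<in> U. hom_vanishes C {X} {Y}}"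

lemma subcategory_orth:
  assumes "S \<subseteq> Ob C"
  shows "subcategory C (left_orth S)" "subcategory C (right_orth S)"
proof -
  show "subcategory C (left_orth S)"
    unfolding subcategory_def left_orth_def
    using assms retract_hom_vanishes_left[OF isomorphic_retract[OF isomorphic_sym]] isomorphic_Ob by blast
  show "subcategory C (right_orth S)"
    unfolding subcategory_def right_orth_def
    using assms retract_hom_vanishes_right[OF isomorphic_retract[OF isomorphic_sym]] isomorphic_Ob by blast
qed

lemma zero_in_orth:
  assumes "is_zero_object C N" "S \<subseteq> Ob C"
  shows "N \<in> left_orth S" "N \<in> right_orth S"
  using assms hom_vanishes_singleton_Id[of N] is_zero_object_iff
  unfolding left_orth_def right_orth_def by auto

lemma thick_left_orth:
  assumes "S \<subseteq> Ob C"
  shows "thick_extension_closed (left_orth S)"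
  unfolding thick_extension_closed_def additive_subcategory_def
proof (intro conjI)
  show "subcategory C (left_orth S)" using subcategory_orth assms by blast
  show "\<exists>Z. is_zero_object C Z \<and> Z \<in> left_orth S" using ex_zero_object zero_in_orth assms by blast
  show "\<forall>A B Sa. A \<in> left_orth S \<and> B \<in> left_orth S \<and> is_direct_sum C A B Sa \<longrightarrow> Sa \<in> left_orth S"
    using direct_sum_hom_vanishes(1) assms unfolding left_orth_def is_direct_sum_def by blast
  show "closed_under_summands C (left_orth S)"
    unfolding closed_under_summands_def left_orth_def
    using direct_sum_retract retract_hom_vanishes_left retract_Ob assms by blast
  show "star C (left_orth S) (left_orth S) \<subseteq> left_orth S"
    unfolding left_orth_def mem_star subset_iff using triangle_hom_vanishes_left triangle_Ob assms by blast
qed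

lemma thick_right_orth:
  assumes "S \<subseteq> Ob C"
  shows "thick_extension_closed (right_orth S)"
  unfolding thick_extension_closed_def additive_subcategory_def
proof (intro conjI)
  show "subcategory C (right_orth S)" using subcategory_orth assms by blast
  show "\<exists>Z. is_zero_object C Z \<and> Z \<in> right_orth S" using ex_zero_object zero_in_orth assms by blast
  show "\<forall>A B Sa. A \<in> right_orth S \<and> B \<in> right_orth S \<and> is_direct_sum C A B Sa \<longrightarrow> Sa \<in> right_orth S"
    using direct_sum_hom_vanishes(2) assms unfolding right_orth_def is_direct_sum_def by blast
  show "closed_under_summands C (right_orth S)"
    unfolding closed_under_summands_def right_orth_def
    using direct_sum_retract retract_hom_vanishes_right retract_Ob assms by blast
  show "star C (right_orth S) (right_orth S) \<subseteq> right_orth S"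
    unfolding right_orth_def mem_star subset_iff using triangle_hom_vanishes_right triangle_Ob assms by blast
qed

lemma thick_Int:
  assumes "thick_extension_closed U" "thick_extension_closed V"
    and zero: "\<And>N. is_zero_object C N \<Longrightarrow> N \<in> U"
  shows "thick_extension_closed (U \<inter> V)"
proof -
  have "star C (U \<inter> V) (U \<inter> V) \<subseteq> U \<inter> V"
    using assms star_mono[of "U \<inter> V" U "U \<inter> V" U] star_mono[of "U \<inter> V" V "U \<inter> V" V]
    unfolding thick_extension_closed_def by blast
  moreover have "subcategory C (U \<inter> V)"
    using assms subcategory_Int unfolding thick_extension_closed_def additive_subcategory_def by blast
  ultimately show ?thesis
    using assms unfolding thick_extension_closed_def additive_subcategory_def closed_under_summands_def by blast
qed

section \<open>t-structures as s-torsion pairs of the whole category\<close>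

text \<open>
  The pair consists of the halves in degrees \<open>\<le> 0\<close> and \<open>\<ge> 1\<close> of a t-structure. The closure of the
  halves under shifts is replaced by the vanishing of negative first extensions, so that the axioms are
  those of an s-torsion pair and are easy to verify for pairs assembled with \<open>star\<close>.
\<close>

definition aisle_pair where
  "aisle_pair U W \<longleftrightarrow> subcategory C U \<and> subcategory C W \<and> Ob C = star C U W \<and>
     hom_vanishes C U W \<and> hom_vanishes C U (shift_sub C W (- 1))"

lemma aisle_pairD:
  assumes "aisle_pair U W"
  shows "subcategory C U" "subcategory C W" "Ob C = star C U W"
    "hom_vanishes C U W" "hom_vanishes C U (shift_sub C W (- 1))"
  using assms by (auto simp: aisle_pair_def)

text \<open>
  In the triangle \<open>u \<rightarrow> X \<rightarrow> w\<close> of an object \<open>X\<close> with \<open>Hom(X, W) = 0\<close>, both \<open>X\<close> and \<open>u[1]\<close> have no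
  maps to \<open>w\<close>; the latter because \<open>Hom(U, W[-1]) = 0\<close>. Hence \<open>Hom(w, w) = 0\<close> and \<open>u \<cong> X\<close>. The dual
  argument applies to the other half. Closure of the halves under shifts is a consequence.
\<close>

lemma aisle_pair_orth:
  assumes "aisle_pair U W"
  shows "U = left_orth W" "W = right_orth U"
proof -
  note a = aisle_pairD[OF assms]
  have sub: "U \<subseteq> Ob C" "W \<subseteq> Ob C" using a(1,2) by (auto simp: subcategory_def)
  have incl: "U \<subseteq> left_orth W" "W \<subseteq> right_orth U"
    using sub hom_vanishesD[OF a(4)] unfolding left_orth_def right_orth_def by blast+
  have "X \<in> U" if X: "X \<in> left_orth W" for X
  proof -
    have "X \<in> star C U W" using X a(3) by (auto simp: left_orth_def)
    then obtain u w where t: "u \<in> U" "w \<in> W" "triangle u X w" by (rule starE)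
    obtain w' where w': "is_shift (- 1) w w'" using ex_is_shift sub t by blast
    have "hom_vanishes C {u} {w'}" using hom_vanishesD[OF a(5) t(1)] shift_subI[OF t(2) w'] by blast
    moreover have "is_shift 1 u (Sh C u)" "is_shift 1 w' w"
      using is_shift_Sh is_shift_sym[OF w'] sub t by auto
    ultimately have "hom_vanishes C {Sh C u} {w}" using is_shift_hom_vanishes by blast
    moreover have "hom_vanishes C {X} {w}" using X t by (auto simp: left_orth_def)
    ultimately have "hom_vanishes C {w} {w}"
      using triangle_hom_vanishes_left[OF triangle_rotate[OF t(3)]] sub t by blast
    then have "is_zero_object C w"
      using is_zero_object_iff Id_in_Hom hom_vanishes_singletonD sub t by blast
    then have "isomorphic C u X" using triangle_zero_right t by blast
    then show "X \<in> U" using subcategory_iso a t by blast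
  qed
  then show "U = left_orth W" using incl by blast
  have "X \<in> W" if X: "X \<in> right_orth U" for X
  proof -
    have "X \<in> star C U W" using X a(3) by (auto simp: right_orth_def)
    then obtain u w where t: "u \<in> U" "w \<in> W" "triangle u X w" by (rule starE)
    obtain w' where w': "w' \<in> shift_sub C W (- 1)" "triangle w' u X"
      using triangle_rotate_back_shift[OF t(3,2) a(2)] .
    have "hom_vanishes C {u} {w'}" using hom_vanishesD[OF a(5) t(1) w'(1)] .
    moreover have "hom_vanishes C {u} {X}" using X t by (auto simp: right_orth_def)
    ultimately have "hom_vanishes C {u} {u}"
      using triangle_hom_vanishes_right[OF w'(2)] sub t by blast
    then have "is_zero_object C u"
      using is_zero_object_iff Id_in_Hom hom_vanishes_singletonD sub t by blast
    then have "isomorphic C w X" using triangle_zero_left t isomorphic_sym by blast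
    then show "X \<in> W" using subcategory_iso a t by blast
  qed
  then show "W = right_orth U" using incl by blast
qed

lemma aisle_pair_shift:
  assumes "aisle_pair U W"
  shows "aisle_pair (shift_sub C U n) (shift_sub C W n)"
proof -
  note a = aisle_pairD[OF assms]
  have "Ob C \<subseteq> shift_sub C (Ob C) n"
    using ex_is_shift[of _ "- n"] is_shift_sym is_shift_Ob shift_subI
    by (metis (no_types, lifting) minus_minus subsetI)
  then have "Ob C = shift_sub C (Ob C) n" using shift_sub_Ob by blast
  also have "\<dots> = shift_sub C (star C U W) n" using a(3) by (rule arg_cong)
  also have "\<dots> = star C (shift_sub C U n) (shift_sub C W n)" by (rule shift_sub_star[OF a(1,2)])
  finally have 1: "Ob C = star C (shift_sub C U n) (shift_sub C W n)" .
  have "shift_sub C (shift_sub C W (- 1)) n = shift_sub C (shift_sub C W n) (- 1)"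
    by (simp add: shift_sub_add[OF a(2)] add.commute)
  then have "hom_vanishes C (shift_sub C U n) (shift_sub C (shift_sub C W n) (- 1))"
    using hom_vanishes_shift_sub[OF a(1) subcategory_shift_sub[OF a(2)] a(5), of n] by simp
  then show ?thesis
    unfolding aisle_pair_def
    using 1 hom_vanishes_shift_sub[OF a(1,2,4), of n] subcategory_shift_sub a(1,2) by blast
qed

lemma aisle_shift_le:
  assumes "aisle_pair U W"
  shows "shift_sub C U (int n) \<subseteq> U"
proof (induction n)
  case 0
  then show ?case using shift_sub_0 aisle_pairD(1)[OF assms] by simp
next
  case (Suc n)
  note a = aisle_pairD[OF assms]
  have "hom_vanishes C (shift_sub C U 1) W"
    using hom_vanishes_shift_sub[OF a(1) subcategory_shift_sub[OF a(2)] a(5), of 1]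
    by (simp add: shift_sub_add[OF a(2)] shift_sub_0[OF a(2)])
  then have "shift_sub C U 1 \<subseteq> left_orth W"
    using shift_sub_Ob hom_vanishesD unfolding left_orth_def by blast
  then have "shift_sub C U 1 \<subseteq> U" using aisle_pair_orth(1)[OF assms] by blast
  moreover have "shift_sub C U (int (Suc n)) = shift_sub C (shift_sub C U (int n)) 1"
    using shift_sub_add[OF a(1)] by (simp add: add.commute)
  ultimately show ?case using Suc shift_sub_mono by blast
qed

lemma aisle_antimono:
  assumes "aisle_pair U W" "a \<ge> b"
  shows "shift_sub C U a \<subseteq> shift_sub C U b"
proof -
  have "shift_sub C U a = shift_sub C (shift_sub C U b) (int (nat (a - b)))"
    using shift_sub_add[OF aisle_pairD(1)[OF assms(1)]] assms(2) by simp
  then show ?thesis using aisle_shift_le[OF aisle_pair_shift[OF assms(1)]] by metis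
qed

lemma aisle_pair_hom_vanishes:
  assumes "aisle_pair U W" "a \<ge> b"
  shows "hom_vanishes C (shift_sub C U a) (shift_sub C W b)"
  using aisle_pairD(4)[OF aisle_pair_shift[OF assms(1)]] aisle_antimono[OF assms]
  by (rule hom_vanishes_mono) simp

lemma coaisle_mono:
  assumes "aisle_pair U W" "a \<le> b"
  shows "shift_sub C W a \<subseteq> shift_sub C W b"
proof -
  have "shift_sub C W a \<subseteq> right_orth (shift_sub C U b)"
    using aisle_pair_hom_vanishes[OF assms] hom_vanishesD shift_sub_Ob unfolding right_orth_def by blast
  then show ?thesis using aisle_pair_orth(2)[OF aisle_pair_shift[OF assms(1)]] by blast
qed

lemma aisle_pair_thick:
  assumes "aisle_pair U W"
  shows "thick_extension_closed U" "thick_extension_closed W"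
    and "is_zero_object C N \<Longrightarrow> N \<in> U" "is_zero_object C N \<Longrightarrow> N \<in> W"
proof -
  have sub: "U \<subseteq> Ob C" "W \<subseteq> Ob C" using aisle_pairD(1,2)[OF assms] by (auto simp: subcategory_def)
  note o = aisle_pair_orth[OF assms]
  show "thick_extension_closed U" using thick_left_orth[OF sub(2), folded o(1)] .
  show "thick_extension_closed W" using thick_right_orth[OF sub(1), folded o(2)] .
  show "N \<in> U" "N \<in> W" if "is_zero_object C N"
    using zero_in_orth(1)[OF that sub(2), folded o(1)] zero_in_orth(2)[OF that sub(1), folded o(2)] .
qed

lemma t_structure_aisle_pair:
  assumes "t_structure C U V"
  shows "aisle_pair U (shift_sub C V (- 1))"
proof -
  have t: "subcategory C U" "subcategory C V" "hom_vanishes C U (shift_sub C V (- 1))"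
    "Ob C = star C U (shift_sub C V (- 1))" "shift_sub C V (- 1) \<subseteq> V"
    using assms by (auto simp: t_structure_def)
  have "hom_vanishes C U (shift_sub C (shift_sub C V (- 1)) (- 1))"
    using hom_vanishes_mono[OF t(3) order_refl shift_sub_mono[OF t(5)]] .
  then show ?thesis using t subcategory_shift_sub unfolding aisle_pair_def by blast
qed

lemma aisle_pair_t_structure:
  assumes "aisle_pair U W"
  shows "t_structure C U (shift_sub C W 1)"
proof -
  note a = aisle_pairD[OF assms]
  have "shift_sub C (shift_sub C W 1) (- 1) = W" using shift_sub_add[OF a(2)] shift_sub_0[OF a(2)] by simp
  moreover have "U \<subseteq> shift_sub C U (- 1)"
    using aisle_antimono[OF assms, of "- 1" 0] shift_sub_0[OF a(1)] by simp
  moreover have "W \<subseteq> shift_sub C W 1"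
    using coaisle_mono[OF assms, of 0 1] shift_sub_0[OF a(2)] by simp
  ultimately show ?thesis
    unfolding t_structure_def using a subcategory_shift_sub by simp
qed

text \<open>
  With \<open>W = V[-1]\<close> the half \<open>V[m - 1]\<close> in degrees \<open>\<ge> -(m - 1)\<close> is \<open>W[m]\<close>.
\<close>

lemma extended_heart_iff:
  "extended_heart C m E \<longleftrightarrow> (\<exists>U W. aisle_pair U W \<and> E = shift_sub C W (int m) \<inter> U)"
proof
  assume "extended_heart C m E"
  then obtain U V where t: "t_structure C U V" "E = shift_sub C V (int m - 1) \<inter> U"
    by (auto simp: extended_heart_def extended_heart_of_def)
  have "shift_sub C (shift_sub C V (- 1)) (int m) = shift_sub C V (int m - 1)"
    using shift_sub_add[of V "- 1" "int m"] t by (simp add: t_structure_def)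
  then show "\<exists>U W. aisle_pair U W \<and> E = shift_sub C W (int m) \<inter> U"
    using t_structure_aisle_pair t by metis
next
  assume "\<exists>U W. aisle_pair U W \<and> E = shift_sub C W (int m) \<inter> U"
  then obtain U W where a: "aisle_pair U W" "E = shift_sub C W (int m) \<inter> U" by blast
  have "shift_sub C (shift_sub C W 1) (int m - 1) = shift_sub C W (int m)"
    using shift_sub_add[OF aisle_pairD(2)[OF a(1)]] by simp
  then show "extended_heart C m E"
    unfolding extended_heart_def extended_heart_of_def using aisle_pair_t_structure a by metis
qed

section \<open>Extended hearts\<close>

context
  fixes U W H and m :: nat
  assumes UW: "aisle_pair U W" and H: "H = shift_sub C W (int m) \<inter> U"
begin

lemma heart_sub: "H \<subseteq> U" "H \<subseteq> shift_sub C W (int m)"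
  using H by auto

lemma sub_U: "subcategory C U" and sub_W: "subcategory C W"
  using aisle_pairD[OF UW] by auto

lemma heart_thick: "thick_extension_closed H" and heart_zero: "is_zero_object C N \<Longrightarrow> N \<in> H"
  unfolding H
  using thick_Int aisle_pair_thick[OF UW] aisle_pair_thick[OF aisle_pair_shift[OF UW, of "int m"]]
  by blast+

lemma sub_H: "subcategory C H"
  using heart_thick by (auto simp: thick_extension_closed_def additive_subcategory_def)

lemma heart_star: "star C H H \<subseteq> H"
  using heart_thick by (auto simp: thick_extension_closed_def)

lemma U_star: "star C U U \<subseteq> U" and W_star: "star C (shift_sub C W n) (shift_sub C W n) \<subseteq> shift_sub C W n"
  using aisle_pair_thick[OF UW] aisle_pair_thick[OF aisle_pair_shift[OF UW]]
  by (auto simp: thick_extension_closed_def)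

lemma Um_le: "shift_sub C U (int m) \<subseteq> U"
  using aisle_shift_le[OF UW] .

lemma W_le: "n \<le> int m \<Longrightarrow> shift_sub C W n \<subseteq> shift_sub C W (int m)"
  using coaisle_mono[OF UW] .

lemma shift_heart_sub: "shift_sub C H n \<subseteq> shift_sub C U n" "shift_sub C H n \<subseteq> shift_sub C W (int m + n)"
  using shift_sub_mono[OF heart_sub(1)] shift_sub_mono[OF heart_sub(2)] shift_sub_add[OF sub_W] by auto

lemma heart_hom_vanishes: "a \<ge> int m + b \<Longrightarrow> hom_vanishes C (shift_sub C H a) (shift_sub C H b)"
  using hom_vanishes_mono[OF aisle_pair_hom_vanishes[OF UW]] shift_heart_sub by meson

text \<open>
  The truncation triangle of \<open>X \<in> U\<close> for the shifted t-structure has its first term in \<open>U[m] \<subseteq> U\<close>, so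
  its last term is an extension of objects of \<open>U\<close> and lies in \<open>W[m] \<inter> U\<close>.
\<close>

lemma aisle_decomp: "U = star C (shift_sub C U (int m)) H"
proof
  show "star C (shift_sub C U (int m)) H \<subseteq> U" using star_mono[OF Um_le heart_sub(1)] U_star by blast
  show "U \<subseteq> star C (shift_sub C U (int m)) H"
  proof
    fix X assume X: "X \<in> U"
    then have "X \<in> star C (shift_sub C U (int m)) (shift_sub C W (int m))"
      using aisle_pairD(3)[OF aisle_pair_shift[OF UW]] subcategory_Ob[OF sub_U] by blast
    then obtain u w where t: "u \<in> shift_sub C U (int m)" "w \<in> shift_sub C W (int m)" "triangle u X w"
      by (rule starE)
    have "u \<in> U" using t Um_le by blast
    then have "Sh C u \<in> U" using Sh_mem_shift_sub[OF sub_U] aisle_shift_le[OF UW, of 1] by auto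
    then have "w \<in> U" using starI[OF X _ triangle_rotate[OF t(3)]] U_star by blast
    then show "X \<in> star C (shift_sub C U (int m)) H" using starI[OF t(1) _ t(3)] t(2) H by blast
  qed
qed

end

section \<open>Tilting an extended heart at an s-torsion pair\<close>

lemma s_torsion_pairD:
  assumes "s_torsion_pair C H T F"
  shows "T \<subseteq> H" "F \<subseteq> H" "subcategory C T" "subcategory C F"
    "closed_under_summands C T" "closed_under_summands C F"
    "hom_vanishes C T F" "H = star C T F" "hom_vanishes C T (shift_sub C F (- 1))"
    "\<exists>N \<in> T. is_zero_object C N" "\<exists>N \<in> F. is_zero_object C N"
  using assms unfolding s_torsion_pair_def additive_subcategory_def by blast+

lemma star_absorb:
  assumes "\<exists>N \<in> Z. is_zero_object C N" "U \<subseteq> Ob C"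
  shows "U \<subseteq> star C U Z" "U \<subseteq> star C Z U"
proof -
  obtain N where N: "N \<in> Z" "is_zero_object C N" using assms by blast
  show "U \<subseteq> star C U Z" "U \<subseteq> star C Z U"
    using starI[OF _ N(1) triangle_zeroI(1)[OF _ N(2)]] starI[OF N(1) _ triangle_zeroI(2)[OF _ N(2)]] assms(2)
    by blast+
qed

lemma zero_in_shift_sub:
  assumes "\<exists>N \<in> Z. is_zero_object C N"
  shows "\<exists>N \<in> shift_sub C Z n. is_zero_object C N"
proof -
  obtain N where N: "N \<in> Z" "is_zero_object C N" using assms by blast
  obtain N' where N': "is_shift n N N'" using ex_is_shift N is_zero_object_iff by blast
  have "hom_vanishes C {N} {N}" using hom_vanishes_singleton_Id N is_zero_object_iff by blast
  then have "hom_vanishes C {N'} {N'}" using is_shift_hom_vanishes N' by blast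
  then have "is_zero_object C N'"
    using is_zero_object_iff hom_vanishes_singletonD Id_in_Hom is_shift_Ob[OF N'] by blast
  then show ?thesis using shift_subI[OF N(1) N'] by blast
qed

text \<open>
  The torsion part of \<open>X\<close> maps to \<open>X\<close> by zero, so \<open>X\<close> is a summand of its torsion-free part.
\<close>

lemma s_torsion_pair_free_mem:
  assumes "s_torsion_pair C H T F" "X \<in> H" "\<And>t. t \<in> T \<Longrightarrow> hom_vanishes C {t} {X}"
  shows "X \<in> F"
proof -
  note tf = s_torsion_pairD[OF assms(1)]
  have "X \<in> star C T F" using assms tf(8) by simp
  then obtain t f where t: "t \<in> T" "f \<in> F" "triangle t X f" by (rule starE)
  show ?thesis
    using summand_closed_retract[OF tf(6) triangle_retract_right[OF t(3) assms(3)[OF t(1)]] t(2)] .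
qed

lemma s_torsion_pair_torsion_mem:
  assumes "s_torsion_pair C H T F" "X \<in> H" "\<And>f. f \<in> F \<Longrightarrow> hom_vanishes C {X} {f}"
  shows "X \<in> T"
proof -
  note tf = s_torsion_pairD[OF assms(1)]
  have "X \<in> star C T F" using assms tf(8) by simp
  then obtain t f where t: "t \<in> T" "f \<in> F" "triangle t X f" by (rule starE)
  show ?thesis
    using summand_closed_retract[OF tf(5) triangle_retract_left[OF t(3) assms(3)[OF t(2)]] t(1)] .
qed

lemma s_torsion_pair_le_iff:
  assumes "s_torsion_pair C H T F" "s_torsion_pair C H T' F'"
  shows "T \<subseteq> T' \<longleftrightarrow> F' \<subseteq> F"
proof
  assume "T \<subseteq> T'"
  then show "F' \<subseteq> F"
    using s_torsion_pair_free_mem[OF assms(1)] s_torsion_pairD(2,7)[OF assms(2)] hom_vanishesD by blast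
next
  assume "F' \<subseteq> F"
  then show "T \<subseteq> T'"
    using s_torsion_pair_torsion_mem[OF assms(2)] s_torsion_pairD(1,7)[OF assms(1)] hom_vanishesD by blast
qed

lemma s_torsion_pair_unique:
  "s_torsion_pair C H T F \<Longrightarrow> s_torsion_pair C H T F' \<Longrightarrow> F = F'"
  using s_torsion_pair_le_iff by blast

text \<open>
  The extended heart attached to \<open>(T, F)\<close>; for \<open>m = 1\<close> this is the Happel-Reiten-Smalo tilt.
\<close>

definition tilt where
  "tilt m T F = star C (shift_sub C F (int m)) T"

lemma tilt_shift_back:
  assumes "s_torsion_pair C H T F"
  shows "shift_sub C (tilt m T F) (- int m) = star C F (shift_sub C T (- int m))"
  using shift_sub_star[OF subcategory_shift_sub] s_torsion_pairD(3,4)[OF assms] shift_sub_add shift_sub_0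
  by (simp add: tilt_def)

lemma tilt_contains:
  assumes "s_torsion_pair C H T F"
  shows "T \<subseteq> tilt m T F" "F \<subseteq> shift_sub C (tilt m T F) (- int m)"
proof -
  note tf = s_torsion_pairD[OF assms]
  have Ob: "T \<subseteq> Ob C" "F \<subseteq> Ob C" using tf by (auto simp: subcategory_def)
  show "T \<subseteq> tilt m T F" unfolding tilt_def using star_absorb(2)[OF zero_in_shift_sub[OF tf(11)] Ob(1)] .
  show "F \<subseteq> shift_sub C (tilt m T F) (- int m)"
    unfolding tilt_shift_back[OF assms] using star_absorb(1)[OF zero_in_shift_sub[OF tf(10)] Ob(2)] .
qed

lemma tilt_heart_le:
  assumes "s_torsion_pair C H T F"
  shows "heart_le C m (tilt m T F) H"
  unfolding heart_le_def
proof
  note tf = s_torsion_pairD[OF assms]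
  show "tilt m T F \<subseteq> star C (shift_sub C H (int m)) H"
    unfolding tilt_def using star_mono[OF shift_sub_mono[OF tf(2)] tf(1)] .
  have "star C T F \<subseteq> star C (tilt m T F) (shift_sub C (tilt m T F) (- int m))"
    using star_mono[OF tilt_contains[OF assms]] .
  then show "H \<subseteq> star C (tilt m T F) (shift_sub C (tilt m T F) (- int m))" using tf(8) by simp
qed

text \<open>
  Absorbing one factor at a time: \<open>F[m] * T \<subseteq> H[m] * T' = T'[m] * (F'[m] * T')\<close> and
  \<open>F'[m] * T' \<subseteq> F[m] * H = (F[m] * T) * F\<close>, where the last step of each chain inserts \<open>H = T' * F'\<close>
  and \<open>H = T * F\<close>.
\<close>

lemma tilt_mono:
  assumes tf: "s_torsion_pair C H T F" and tf': "s_torsion_pair C H T' F'" and le: "T \<subseteq> T'"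
  shows "heart_le C m (tilt m T F) (tilt m T' F')"
  unfolding heart_le_def
proof
  note D = s_torsion_pairD[OF tf] and D' = s_torsion_pairD[OF tf']
  have le': "F' \<subseteq> F" using s_torsion_pair_le_iff[OF tf tf'] le by blast
  have "shift_sub C H (int m) = star C (shift_sub C T' (int m)) (shift_sub C F' (int m))"
    using arg_cong[OF D'(8), of "\<lambda>S. shift_sub C S (int m)"] shift_sub_star[OF D'(3,4)] by metis
  then have "star C (shift_sub C H (int m)) T' = star C (shift_sub C T' (int m)) (tilt m T' F')"
    by (simp only: tilt_def star_assoc)
  moreover have "tilt m T F \<subseteq> star C (shift_sub C H (int m)) T'"
    unfolding tilt_def using star_mono[OF shift_sub_mono[OF D(2)] le] .
  moreover have "star C (shift_sub C T' (int m)) (tilt m T' F')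
      \<subseteq> star C (shift_sub C (tilt m T' F') (int m)) (tilt m T' F')"
    using star_mono[OF shift_sub_mono[OF tilt_contains(1)[OF tf']] order_refl] .
  ultimately show "tilt m T F \<subseteq> star C (shift_sub C (tilt m T' F') (int m)) (tilt m T' F')" by blast
  have "star C (shift_sub C F (int m)) H = star C (shift_sub C F (int m)) (star C T F)"
    using D(8) by simp
  also have "\<dots> = star C (tilt m T F) F" by (simp only: tilt_def star_assoc)
  finally have "star C (shift_sub C F (int m)) H = star C (tilt m T F) F" .
  moreover have "tilt m T' F' \<subseteq> star C (shift_sub C F (int m)) H"
    unfolding tilt_def using star_mono[OF shift_sub_mono[OF le'] D'(1)] .
  moreover have "star C (tilt m T F) F \<subseteq> star C (tilt m T F) (shift_sub C (tilt m T F) (- int m))"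
    using star_mono[OF order_refl tilt_contains(2)[OF tf]] .
  ultimately show "tilt m T' F' \<subseteq> star C (tilt m T F) (shift_sub C (tilt m T F) (- int m))" by blast
qed

context
  fixes U W H and m :: nat
  assumes UW: "aisle_pair U W" and H: "H = shift_sub C W (int m) \<inter> U"
begin

text \<open>
  The decomposition \<open>D = U[m] * T * F * W\<close>, split in the middle. Both vanishing conditions reduce to
  the four combinations of a factor on the left with a factor on the right.
\<close>

lemma tilt_aisle_pair:
  assumes "s_torsion_pair C H T F"
  shows "aisle_pair (star C (shift_sub C U (int m)) T) (star C F W)"
  unfolding aisle_pair_def
proof (intro conjI subcategory_star)
  note tf = s_torsion_pairD[OF assms] and hs = heart_sub[OF UW H]
  note su = aisle_pairD(1)[OF UW] and sw = aisle_pairD(2)[OF UW]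
  let ?Um = "shift_sub C U (int m)"
  have uw: "hom_vanishes C ?Um (shift_sub C W b)" if "b \<le> int m" for b
    using aisle_pair_hom_vanishes[OF UW that] .
  have tw: "hom_vanishes C T (shift_sub C W b)" if "b \<le> 0" for b
    using hom_vanishes_mono[OF aisle_pair_hom_vanishes[OF UW that]] shift_sub_0[OF su] tf(1) hs(1) by auto
  show "Ob C = star C (star C ?Um T) (star C F W)"
  proof -
    have "star C (star C ?Um T) (star C F W) = star C ?Um (star C (star C T F) W)"
      by (simp only: star_assoc)
    also have "\<dots> = star C (star C ?Um H) W" by (simp only: tf(8)[symmetric] star_assoc)
    also have "\<dots> = star C U W" using aisle_decomp[OF UW H] by simp
    also have "\<dots> = Ob C" using aisle_pairD(3)[OF UW] by simp
    finally show ?thesis by simp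
  qed
  show "hom_vanishes C (star C ?Um T) (star C F W)"
  proof (rule hom_vanishes_star_left[OF _ _ star_Ob]; rule hom_vanishes_star_right)
    show "hom_vanishes C ?Um F" using hom_vanishes_mono[OF uw[of "int m"] order_refl] tf(2) hs(2) by auto
    show "hom_vanishes C ?Um W" using uw[of 0] shift_sub_0[OF sw] by simp
    show "hom_vanishes C T F" by (rule tf(7))
    show "hom_vanishes C T W" using tw[of 0] shift_sub_0[OF sw] by simp
    show "?Um \<subseteq> Ob C" "T \<subseteq> Ob C" using shift_sub_Ob tf(3) by (auto simp: subcategory_def)
  qed
  have "hom_vanishes C (star C ?Um T) (star C (shift_sub C F (- 1)) (shift_sub C W (- 1)))"
  proof (rule hom_vanishes_star_left[OF _ _ star_Ob]; rule hom_vanishes_star_right)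
    have "shift_sub C F (- 1) \<subseteq> shift_sub C W (int m - 1)"
      using shift_sub_mono[of F "shift_sub C W (int m)" "- 1"] tf(2) hs(2) shift_sub_add[OF sw] by auto
    then show "hom_vanishes C ?Um (shift_sub C F (- 1))"
      using hom_vanishes_mono[OF uw[of "int m - 1"] order_refl] by auto
    show "hom_vanishes C ?Um (shift_sub C W (- 1))" using uw[of "- 1"] by simp
    show "hom_vanishes C T (shift_sub C F (- 1))" by (rule tf(9))
    show "hom_vanishes C T (shift_sub C W (- 1))" using tw[of "- 1"] by simp
    show "?Um \<subseteq> Ob C" "T \<subseteq> Ob C" using shift_sub_Ob tf(3) by (auto simp: subcategory_def)
  qed
  then show "hom_vanishes C (star C ?Um T) (shift_sub C (star C F W) (- 1))"
    using shift_sub_star[OF tf(4) sw] by simp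
qed

text \<open>
  Let \<open>A = U[m] * T\<close> and \<open>B = F * W\<close>. An object \<open>X \<in> A\<close> comes with a triangle \<open>u \<rightarrow> X \<rightarrow> t\<close>, and
  \<open>X \<in> F[m] * T\<close> holds once \<open>u \<in> F[m]\<close>. Now \<open>U[m] = U[2m] * T[m] * F[m] = A[m] * F[m]\<close>, and the
  \<open>A[m]\<close>-part of \<open>u\<close> maps to \<open>u\<close> by zero if \<open>X \<in> B[m]\<close>; hence \<open>u\<close> is a summand of an object of
  \<open>F[m]\<close>.
\<close>

lemma tilt_extended_heart:
  assumes "s_torsion_pair C H T F"
  shows "extended_heart C m (tilt m T F)"
proof -
  note tf = s_torsion_pairD[OF assms] and hs = heart_sub[OF UW H]
  note su = aisle_pairD(1)[OF UW] and sw = aisle_pairD(2)[OF UW]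
  define Um where "Um = shift_sub C U (int m)"
  define A where "A = star C Um T"
  define B where "B = star C F W"
  have AB: "aisle_pair A B" unfolding A_def B_def Um_def by (rule tilt_aisle_pair[OF assms])
  have Bm: "shift_sub C B (int m) = star C (shift_sub C F (int m)) (shift_sub C W (int m))"
    unfolding B_def by (rule shift_sub_star[OF tf(4) sw])
  have FU: "shift_sub C F (int m) \<subseteq> Um" unfolding Um_def using shift_sub_mono tf(2) hs(1) by blast
  have AU: "A \<subseteq> U" unfolding A_def Um_def
    using star_mono[of _ U T U] Um_le[OF UW H] U_star[OF UW H] tf(1) hs(1) by blast
  have Um: "Um = star C (shift_sub C A (int m)) (shift_sub C F (int m))"
  proof -
    have "Um = shift_sub C (star C Um (star C T F)) (int m)"
      unfolding Um_def using arg_cong[OF aisle_decomp[OF UW H]] tf(8) by metis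
    also have "\<dots> = shift_sub C (star C A F) (int m)" by (simp only: A_def star_assoc)
    also have "\<dots> = star C (shift_sub C A (int m)) (shift_sub C F (int m))"
      using shift_sub_star[OF _ tf(4)] subcategory_star A_def by simp
    finally show ?thesis .
  qed
  have "tilt m T F = shift_sub C B (int m) \<inter> A"
  proof (intro equalityI subsetI)
    fix X assume "X \<in> tilt m T F"
    then show "X \<in> shift_sub C B (int m) \<inter> A"
      unfolding tilt_def Bm A_def
      using star_mono[OF order_refl, of T "shift_sub C W (int m)" "shift_sub C F (int m)"]
        star_mono[OF FU order_refl, of T] tf(1) hs(2) by blast
  next
    fix X assume X: "X \<in> shift_sub C B (int m) \<inter> A"
    then have "X \<in> star C Um T" by (simp add: A_def)
    then obtain u t where t: "u \<in> Um" "t \<in> T" "triangle u X t" by (rule starE)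
    have "u \<in> star C (shift_sub C A (int m)) (shift_sub C F (int m))" using t(1) Um by simp
    then obtain a f where a: "a \<in> shift_sub C A (int m)" "f \<in> shift_sub C F (int m)" "triangle a u f"
      by (rule starE)
    have aO: "a \<in> Ob C" using a shift_sub_Ob by blast
    obtain t' where t': "t' \<in> shift_sub C T (- 1)" "triangle t' u X"
      using triangle_rotate_back_shift[OF t(3,2) tf(3)] .
    have "T \<subseteq> shift_sub C W (int m)" using tf(1) hs(2) by blast
    then have "t' \<in> shift_sub C W (int m - 1)"
      using t'(1) shift_sub_mono[of T "shift_sub C W (int m)" "- 1"] shift_sub_add[OF sw] by auto
    moreover have "a \<in> shift_sub C U (int m)" using a(1) AU shift_sub_mono by blast
    \<comment> \<open>\<open>u\<close> is an extension of \<open>X\<close> by \<open>t' = t[-1]\<close>, and \<open>a\<close> maps to neither.\<close>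
    ultimately have "hom_vanishes C {a} {t'}"
      using hom_vanishesD[OF aisle_pair_hom_vanishes[OF UW, of "int m - 1" "int m"]] by simp
    moreover have "hom_vanishes C {a} {X}"
      using hom_vanishesD[OF aisle_pair_hom_vanishes[OF AB order_refl] a(1)] X by blast
    ultimately have "hom_vanishes C {a} {u}" using triangle_hom_vanishes_right[OF t'(2) _ _ aO] by blast
    then have "retract u f" using triangle_retract_right[OF a(3)] by blast
    then have "u \<in> shift_sub C F (int m)" using summand_closed_shift[OF tf(4,6) _ a(2)] by blast
    then show "X \<in> tilt m T F" unfolding tilt_def using starI[OF _ t(2,3)] by blast
  qed
  then show ?thesis using extended_heart_iff AB by blast
qed

text \<open>
  There are no maps from \<open>H[m]\<close> to \<open>H\<close>. So the first arrow of \<open>f[m] \<rightarrow> X \<rightarrow> t\<close> vanishes for \<open>X \<in> H\<close>,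
  and the second arrow of \<open>f \<rightarrow> X \<rightarrow> t[-m]\<close> does.
\<close>

lemma tilt_Int_heart:
  assumes "s_torsion_pair C H T F"
  shows "tilt m T F \<inter> H = T" "shift_sub C (tilt m T F) (- int m) \<inter> H = F"
proof -
  note tf = s_torsion_pairD[OF assms] and hs = heart_sub[OF UW H]
  have HH: "hom_vanishes C (shift_sub C H a) (shift_sub C H b)" if "a \<ge> int m + b" for a b
    using heart_hom_vanishes[OF UW H that] .
  note H0 = shift_sub_0[OF sub_H[OF UW H]]
  have "X \<in> T" if X: "X \<in> tilt m T F" "X \<in> H" for X
  proof -
    obtain f t where t: "f \<in> shift_sub C F (int m)" "t \<in> T" "triangle f X t"
      using X(1) unfolding tilt_def by (rule starE)
    have "f \<in> shift_sub C H (int m)" using t(1) shift_sub_mono[OF tf(2)] by blast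
    then have "hom_vanishes C {f} {X}" using hom_vanishesD[OF HH[of 0 "int m"]] X(2) H0 by simp
    then show ?thesis using summand_closed_retract[OF tf(5) triangle_retract_right[OF t(3)] t(2)] by blast
  qed
  then show "tilt m T F \<inter> H = T" using tilt_contains(1)[OF assms] tf(1) by blast
  have "X \<in> F" if X: "X \<in> shift_sub C (tilt m T F) (- int m)" "X \<in> H" for X
  proof -
    obtain f t where t: "f \<in> F" "t \<in> shift_sub C T (- int m)" "triangle f X t"
      using X(1) unfolding tilt_shift_back[OF assms] by (rule starE)
    have "t \<in> shift_sub C H (- int m)" using t(2) shift_sub_mono[OF tf(1)] by blast
    then have "hom_vanishes C {X} {t}" using hom_vanishesD[OF HH[of "- int m" 0]] X(2) H0 by simp
    then show ?thesis using summand_closed_retract[OF tf(6) triangle_retract_left[OF t(3)] t(1)] by blast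
  qed
  then show "shift_sub C (tilt m T F) (- int m) \<inter> H = F" using tilt_contains(2)[OF assms] tf(2) by blast
qed

text \<open>
  From \<open>E \<subseteq> H[m] * H\<close> follow \<open>E \<subseteq> U\<close> and \<open>E[-m] \<subseteq> W[m]\<close>. In a triangle \<open>e \<rightarrow> h \<rightarrow> e'[-m]\<close> with
  \<open>h \<in> H\<close>, rotation then exhibits \<open>e\<close> as an extension of objects of \<open>W[m]\<close> and \<open>e'[-m]\<close> as an
  extension of objects of \<open>U\<close>, so both lie in \<open>H\<close>. The vanishing conditions are those of \<open>E\<close>
  against \<open>E[-m]\<close> and \<open>E[-m-1]\<close>.

  To recover \<open>E\<close>, take \<open>x \<rightarrow> e \<rightarrow> h\<close> with \<open>x \<in> H[m]\<close>. Membership in the two classes of the s-torsion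
  pair is tested by orthogonality: \<open>h\<close> is an extension of \<open>x[1]\<close> by \<open>e\<close>, neither of which maps to
  \<open>E[-m] \<inter> H\<close>, and \<open>x[-m]\<close> is an extension of \<open>e[-m]\<close> by \<open>h[-m-1]\<close>, neither of which receives maps
  from \<open>E \<inter> H\<close>.
\<close>

lemma heart_below_s_torsion_pair:
  assumes E: "extended_heart C m E" "heart_le C m E H"
  shows "s_torsion_pair C H (E \<inter> H) (shift_sub C E (- int m) \<inter> H)"
    and "tilt m (E \<inter> H) (shift_sub C E (- int m) \<inter> H) = E"
proof -
  obtain U' W' where UW': "aisle_pair U' W'" and E': "E = shift_sub C W' (int m) \<inter> U'"
    using E(1) extended_heart_iff by blast
  note hs = heart_sub[OF UW H]
  note su = aisle_pairD(1)[OF UW] and sw = aisle_pairD(2)[OF UW]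
  note sE = sub_H[OF UW' E'] and sH = sub_H[OF UW H]
  note W0 = shift_sub_0[OF sw] and U0 = shift_sub_0[OF su]
  define F where "F = shift_sub C E (- int m) \<inter> H"
  define T where "T = E \<inter> H"
  have EH: "E \<subseteq> star C (shift_sub C H (int m)) H" and HE: "H \<subseteq> star C E (shift_sub C E (- int m))"
    using E(2) by (auto simp: heart_le_def)
  have EE: "hom_vanishes C E (shift_sub C E b)" if "b \<le> - int m" for b
    using heart_hom_vanishes[OF UW' E', of b 0] that shift_sub_0[OF sE] by simp
  have EU: "E \<subseteq> U"
    using EH star_mono[OF _ hs(1), of "shift_sub C H (int m)" U] shift_heart_sub(1)[OF UW H, of "int m"]
      Um_le[OF UW H] U_star[OF UW H] by blast
  have sF: "subcategory C F" unfolding F_def by (intro subcategory_Int subcategory_shift_sub sE sH)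
  have sT: "subcategory C T" unfolding T_def by (intro subcategory_Int sE sH)
  have EW: "shift_sub C E (- int m) \<subseteq> shift_sub C W (int m)"
  proof -
    have "shift_sub C E (- int m) \<subseteq> shift_sub C (star C (shift_sub C H (int m)) H) (- int m)"
      using EH shift_sub_mono by blast
    also have "\<dots> = star C H (shift_sub C H (- int m))"
      using shift_sub_star[OF subcategory_shift_sub[OF sH] sH] shift_sub_add[OF sH] shift_sub_0[OF sH] by simp
    also have "\<dots> \<subseteq> star C (shift_sub C W (int m)) (shift_sub C W (int m))"
    proof (rule star_mono[OF hs(2)])
      show "shift_sub C H (- int m) \<subseteq> shift_sub C W (int m)"
        using shift_heart_sub(2)[OF UW H, of "- int m"] W_le[OF UW H, of 0] by simp
    qed
    also have "\<dots> \<subseteq> shift_sub C W (int m)" by (rule W_star[OF UW H])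
    finally show ?thesis .
  qed
  have thT: "thick_extension_closed T"
    unfolding T_def using thick_Int[OF heart_thick[OF UW' E'] heart_thick[OF UW H]] heart_zero[OF UW' E'] by blast
  have clE: "closed_under_summands C E" using heart_thick[OF UW' E'] by (simp add: thick_extension_closed_def)
  have thF: "thick_extension_closed F"
  proof -
    \<comment> \<open>\<open>E[-m]\<close> is itself an extended heart, for the shifted t-structure.\<close>
    have "shift_sub C E (- int m) = shift_sub C (shift_sub C W' (- int m)) (int m) \<inter> shift_sub C U' (- int m)"
      unfolding E' using shift_sub_Int[OF subcategory_shift_sub] aisle_pairD(1,2)[OF UW']
      by (simp add: shift_sub_add)
    note * = aisle_pair_shift[OF UW', of "- int m"] this
    show ?thesis unfolding F_def
      using thick_Int[OF heart_thick[OF *] heart_thick[OF UW H]] heart_zero[OF *] by blast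
  qed
  have H_star: "H = star C T F"
  proof
    show "star C T F \<subseteq> H"
      using star_mono[of T H F H] heart_star[OF UW H] unfolding T_def F_def by blast
    show "H \<subseteq> star C T F"
    proof
      fix h assume h: "h \<in> H"
      then obtain e f where e: "e \<in> E" "f \<in> shift_sub C E (- int m)" "triangle e h f"
        using HE starE by blast
      obtain f' where f': "f' \<in> shift_sub C (shift_sub C W (int m)) (- 1)" "triangle f' e h"
        using triangle_rotate_back_shift[OF e(3) _ subcategory_shift_sub[OF sw]] EW e(2) by blast
      have "f' \<in> shift_sub C W (int m)" using f'(1) W_le[OF UW H, of "int m - 1"] shift_sub_add[OF sw] by auto
      then have "e \<in> shift_sub C W (int m)" using starI[OF _ _ f'(2)] h hs(2) W_star[OF UW H] by blast
      then have eT: "e \<in> T" using e(1) EU H unfolding T_def by blast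
      have "Sh C e \<in> U" using Sh_mem_shift_sub[OF su] e(1) EU aisle_shift_le[OF UW, of 1] by auto
      then have "f \<in> U" using starI[OF _ _ triangle_rotate[OF e(3)]] h hs(1) U_star[OF UW H] by blast
      then have "f \<in> F" using e(2) EW H unfolding F_def by blast
      then show "h \<in> star C T F" using starI eT e(3) by blast
    qed
  qed
  have F1: "shift_sub C F (- 1) \<subseteq> shift_sub C E (- int m - 1)"
    using shift_sub_mono[of F "shift_sub C E (- int m)" "- 1"] shift_sub_add[OF sE] unfolding F_def by simp
  have st: "s_torsion_pair C H T F"
    unfolding s_torsion_pair_def
  proof (intro conjI H_star)
    show "T \<subseteq> H" "F \<subseteq> H" by (auto simp: T_def F_def)
    show "additive_subcategory C T" "closed_under_summands C T" "additive_subcategory C F" "closed_under_summands C F"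
      using thT thF by (auto simp: thick_extension_closed_def)
    show "hom_vanishes C T F" using hom_vanishes_mono[OF EE[of "- int m"]] unfolding T_def F_def by auto
    show "hom_vanishes C T (shift_sub C F (- 1))"
      using hom_vanishes_mono[OF EE[of "- int m - 1"] _ F1] unfolding T_def by auto
  qed
  then show "s_torsion_pair C H (E \<inter> H) (shift_sub C E (- int m) \<inter> H)" unfolding T_def F_def .
  have Fm: "shift_sub C F (int m) \<subseteq> E"
    using shift_sub_mono[of F "shift_sub C E (- int m)" "int m"] shift_sub_add[OF sE] shift_sub_0[OF sE]
    unfolding F_def by simp
  have "tilt m T F = E"
  proof
    show "tilt m T F \<subseteq> E"
      unfolding tilt_def using star_mono[OF Fm, of T E] heart_star[OF UW' E'] T_def by blast
    show "E \<subseteq> tilt m T F"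
    proof
      fix e assume e: "e \<in> E"
      then obtain x h where x: "x \<in> shift_sub C H (int m)" "h \<in> H" "triangle x e h" using EH starE by blast
      have eO: "e \<in> Ob C" "x \<in> Ob C" "h \<in> Ob C" using triangle_Ob[OF x(3)] by auto
      have "h \<in> T"
      proof (rule s_torsion_pair_torsion_mem[OF st x(2)])
        fix f assume f: "f \<in> F"
        have fO: "f \<in> Ob C" using subcategory_Ob[OF sF f] .
        have "hom_vanishes C {e} {f}" using hom_vanishesD[OF EE[of "- int m"] e] f unfolding F_def by simp
        moreover have "hom_vanishes C {Sh C x} {f}"
        proof -
          have "Sh C x \<in> shift_sub C H (int m + 1)"
            using Sh_mem_shift_sub[OF subcategory_shift_sub[OF sH] x(1)] shift_sub_add[OF sH] by simp
          then show ?thesis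
            using hom_vanishesD[OF heart_hom_vanishes[OF UW H, of 0 "int m + 1"]] f shift_sub_0[OF sH]
            unfolding F_def by simp
        qed
        ultimately show "hom_vanishes C {h} {f}"
          using triangle_hom_vanishes_left[OF triangle_rotate[OF x(3)] _ _ fO] by blast
      qed
      moreover have "x \<in> shift_sub C F (int m)"
      proof -
        obtain y where y: "is_shift (- int m) x y" using ex_is_shift eO by blast
        then have yx: "is_shift (int m) y x" using is_shift_sym by fastforce
        have yH: "y \<in> H" using is_shift_mem_iff[OF sH yx] x(1) by blast
        obtain e' where e': "is_shift (- int m) e e'" using ex_is_shift eO by blast
        obtain h' where h': "is_shift (- int m) h h'" using ex_is_shift eO by blast
        have "triangle y e' h'" using is_shift_triangle[OF x(3) y e' h'] .
        then obtain k where k: "k \<in> shift_sub C (shift_sub C H (- int m)) (- 1)" "triangle k y e'"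
          using triangle_rotate_back_shift[OF _ shift_subI[OF x(2) h'] subcategory_shift_sub[OF sH]] by blast
        have "y \<in> F"
        proof (rule s_torsion_pair_free_mem[OF st yH])
          fix t assume t: "t \<in> T"
          have tO: "t \<in> Ob C" using subcategory_Ob[OF sT t] .
          have "hom_vanishes C {t} {e'}"
            using hom_vanishesD[OF EE[of "- int m"] _ shift_subI[OF e e']] t unfolding T_def by simp
          moreover have "hom_vanishes C {t} {k}"
            using hom_vanishesD[OF heart_hom_vanishes[OF UW H, of "- int m - 1" 0]] t k(1)
              shift_sub_0[OF sH] shift_sub_add[OF sH] unfolding T_def by simp
          ultimately show "hom_vanishes C {t} {y}"
            using triangle_hom_vanishes_right[OF k(2) _ _ tO] by blast
        qed
        then show ?thesis using shift_subI yx by blast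
      qed
      ultimately show "e \<in> tilt m T F" unfolding tilt_def using starI x(3) by blast
    qed
  qed
  then show "tilt m (E \<inter> H) (shift_sub C E (- int m) \<inter> H) = E" unfolding T_def F_def .
qed

text \<open>
  Objects of \<open>E \<subseteq> E'[m] * E'\<close> have no maps to \<open>E'[-m]\<close>, which contains the torsion-free class attached
  to \<open>E'\<close>.
\<close>

lemma heart_le_torsion_le:
  assumes E: "extended_heart C m E" "heart_le C m E H"
    and E': "extended_heart C m E'" "heart_le C m E' H" and le: "heart_le C m E E'"
  shows "E \<inter> H \<subseteq> E' \<inter> H"
proof
  fix t assume t: "t \<in> E \<inter> H"
  obtain U' W' where UW': "aisle_pair U' W'" and eq: "E' = shift_sub C W' (int m) \<inter> U'"
    using E'(1) extended_heart_iff by blast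
  note st = heart_below_s_torsion_pair(1)[OF E'] and sE = sub_H[OF UW' eq]
  show "t \<in> E' \<inter> H"
  proof (rule s_torsion_pair_torsion_mem[OF st])
    show "t \<in> H" using t by blast
    fix f assume f: "f \<in> shift_sub C E' (- int m) \<inter> H"
    have fO: "f \<in> Ob C" using f shift_sub_Ob by blast
    have "t \<in> star C (shift_sub C E' (int m)) E'" using t le by (auto simp: heart_le_def)
    then obtain x y where x: "x \<in> shift_sub C E' (int m)" "y \<in> E'" "triangle x t y" by (rule starE)
    have "hom_vanishes C {x} {f}"
      using hom_vanishesD[OF heart_hom_vanishes[OF UW' eq, of "- int m" "int m"] x(1)] f by simp
    moreover have "hom_vanishes C {y} {f}"
      using hom_vanishesD[OF heart_hom_vanishes[OF UW' eq, of "- int m" 0]] x(2) f shift_sub_0[OF sE] by simp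
    ultimately show "hom_vanishes C {t} {f}" using triangle_hom_vanishes_left[OF x(3) _ _ fO] by blast
  qed
qed

end

end

lemma is_poset_pullback:
  assumes "\<And>x y. x \<in> A \<Longrightarrow> y \<in> A \<Longrightarrow> R x y \<longleftrightarrow> f x \<subseteq> f y" "inj_on f A"
  shows "is_poset A R"
  unfolding is_poset_def partial_order_on_def preorder_on_def
proof (intro conjI)
  show "refl_on A {(x, y). x \<in> A \<and> y \<in> A \<and> R x y}" using assms(1) by (auto simp: refl_on_def)
  show "trans {(x, y). x \<in> A \<and> y \<in> A \<and> R x y}"
    using assms(1) unfolding trans_def by (auto simp: subset_iff)
  show "antisym {(x, y). x \<in> A \<and> y \<in> A \<and> R x y}"
    using assms unfolding antisym_def inj_on_def by (auto intro: subset_antisym)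
qed auto

section \<open>The correspondence\<close>

theorem theorem1p3:
  fixes D :: "('o, 'a) triangulated_category" and m :: nat and \<H> :: "'o set"
  assumes "triangulated_category D" and "m \<ge> 1" and "extended_heart D m \<H>"
  shows "is_poset (s_torsion_pairs D \<H>) torsion_le \<and>
    is_poset (extended_hearts_below D m \<H>) (heart_le D m) \<and>
    (\<exists>\<phi> \<psi>.
      bij_betw \<phi> (s_torsion_pairs D \<H>) (extended_hearts_below D m \<H>) \<and>
      bij_betw \<psi> (extended_hearts_below D m \<H>) (s_torsion_pairs D \<H>) \<and>
      (\<forall>P \<in> s_torsion_pairs D \<H>. \<psi> (\<phi> P) = P) \<and>
      (\<forall>\<E> \<in> extended_hearts_below D m \<H>. \<phi> (\<psi> \<E>) = \<E>) \<and>
      monotone_on (s_torsion_pairs D \<H>) torsion_le (heart_le D m) \<phi> \<and>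
      monotone_on (extended_hearts_below D m \<H>) (heart_le D m) torsion_le \<psi>)"
proof -
  interpret triangulated_category D by fact
  obtain U W where UW: "aisle_pair U W" and H: "\<H> = shift_sub D W (int m) \<inter> U"
    using assms(3) extended_heart_iff by blast
  let ?S = "s_torsion_pairs D \<H>" and ?X = "extended_hearts_below D m \<H>"
  define \<phi> where "\<phi> P = tilt m (fst P) (snd P)" for P
  define \<psi> where "\<psi> E = (E \<inter> \<H>, shift_sub D E (- int m) \<inter> \<H>)" for E
  have S: "s_torsion_pair D \<H> (fst P) (snd P)" if "P \<in> ?S" for P
    using that by (auto simp: s_torsion_pairs_def)
  have X: "extended_heart D m E" "heart_le D m E \<H>" if "E \<in> ?X" for E
    using that by (auto simp: extended_hearts_below_def)
  have \<phi>X: "\<phi> P \<in> ?X" if "P \<in> ?S" for P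
    unfolding extended_hearts_below_def \<phi>_def
    using tilt_extended_heart[OF UW H S[OF that]] tilt_heart_le[OF S[OF that]] by blast
  have \<psi>S: "\<psi> E \<in> ?S" if "E \<in> ?X" for E
    unfolding s_torsion_pairs_def \<psi>_def using heart_below_s_torsion_pair(1)[OF UW H X[OF that]] by blast
  have \<psi>\<phi>: "\<psi> (\<phi> P) = P" if "P \<in> ?S" for P
    unfolding \<psi>_def \<phi>_def using tilt_Int_heart[OF UW H S[OF that]] by simp
  have \<phi>\<psi>: "\<phi> (\<psi> E) = E" if "E \<in> ?X" for E
    unfolding \<psi>_def \<phi>_def using heart_below_s_torsion_pair(2)[OF UW H X[OF that]] by simp
  have mono_\<phi>: "heart_le D m (\<phi> P) (\<phi> Q)" if "P \<in> ?S" "Q \<in> ?S" "torsion_le P Q" for P Q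
    using tilt_mono[OF S[OF that(1)] S[OF that(2)]] that(3) by (simp add: \<phi>_def torsion_le_def)
  have mono_\<psi>: "torsion_le (\<psi> E) (\<psi> E')" if "E \<in> ?X" "E' \<in> ?X" "heart_le D m E E'" for E E'
    using heart_le_torsion_le[OF UW H X[OF that(1)] X[OF that(2)] that(3)] by (simp add: \<psi>_def torsion_le_def)
  have inj: "inj_on fst ?S"
  proof (rule inj_onI)
    fix P Q assume *: "P \<in> ?S" "Q \<in> ?S" "fst P = fst Q"
    then have "snd P = snd Q" using s_torsion_pair_unique S by metis
    then show "P = Q" using *(3) by (simp add: prod_eq_iff)
  qed
  have "is_poset ?S torsion_le"
    by (rule is_poset_pullback[where f = fst]) (simp_all add: inj torsion_le_def)
  moreover have "is_poset ?X (heart_le D m)"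
  proof (rule is_poset_pullback[where f = "\<lambda>E. fst (\<psi> E)"])
    show "heart_le D m E E' \<longleftrightarrow> fst (\<psi> E) \<subseteq> fst (\<psi> E')" if "E \<in> ?X" "E' \<in> ?X" for E E'
      using mono_\<psi>[OF that] mono_\<phi>[OF \<psi>S[OF that(1)] \<psi>S[OF that(2)]] \<phi>\<psi>[OF that(1)] \<phi>\<psi>[OF that(2)]
      by (auto simp: torsion_le_def)
    have "inj_on \<psi> ?X" using \<phi>\<psi> by (rule inj_on_inverseI)
    moreover have "inj_on fst (\<psi> ` ?X)" using inj \<psi>S by (blast intro: inj_on_subset)
    ultimately show "inj_on (\<lambda>E. fst (\<psi> E)) ?X" using comp_inj_on by (fastforce simp: comp_def)
  qed
  moreover have "bij_betw \<phi> ?S ?X" "bij_betw \<psi> ?X ?S"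
    using \<phi>X \<psi>S \<psi>\<phi> \<phi>\<psi> by (auto intro!: bij_betw_byWitness[where f' = \<psi>] bij_betw_byWitness[where f' = \<phi>])
  moreover have "monotone_on ?S torsion_le (heart_le D m) \<phi>"
    using mono_\<phi> by (rule monotone_onI)
  moreover have "monotone_on ?X (heart_le D m) torsion_le \<psi>"
    using mono_\<psi> by (rule monotone_onI)
  ultimately show ?thesis using \<psi>\<phi> \<phi>\<psi> by blast
qed

end
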